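(* Fix integers $n\geq 1$ and $N\geq n+2$, and let $\alpha\in\mathcal{A}$. Consider the functional $G_{n,N,\alpha}:\mathcal{C}_\alpha(\mathbb{R}^n)\to[0,\infty)$ defined by \[ G_{n,N,\alpha}(f):=\inf_{p\in\mathscr{P}_{\alpha,N}(f)}\{J(f)-J(p)\}. \] Then for every $f\in\mathcal{C}_\alpha(\mathbb{R}^n)$, we have \[ G_{n,N,\alpha}(f)\leq G_{n,N,\alpha}(f^* ), \] where $f^*$ is the symmetric decreasing rearrangement of $f$.
   Context: **The set $\mathcal{A}$.** For $\alpha\in\mathbb{R}\setminus\{0\}$ let $g_\alpha(x)=(1-\alpha x)_+^{1/\alpha}$, where $s_+=\max\{s,0\}$, and let $g_0(x)=e^{-x}$ (the limiting case). $\mathcal{A}$ is the set of all $\alpha\in\mathbb{R}$ such that $g_\alpha$ is strictly decreasing (hence injective) on $\{x\in\mathbb{R}:1-\alpha x>0\}$. We set $g_\alpha(+\infty)=0$. **$\alpha$-concave functions.** For $f:\mathbb{R}^n\to[0,\infty)$, $\mathrm{supp}(f)=\{x:f(x)\neq 0\}$. For $\alpha\in\mathbb{R}$, $f$ is $\alpha$-concave if $\mathrm{supp}(f)$ is convex and for all $x,y\in\mathrm{supp}(f)$ and $\lambda\in[0,1]$ one has $f(\lambda x+(1-\lambda)y)\geq(\lambda f(x)^\alpha+(1-\lambda)f(y)^\alpha)^{1/\alpha}$ if $\alpha\neq 0$, and $f(\lambda x+(1-\lambda)y)\geq f(x)^\lambda f(y)^{1-\lambda}$ if $\alpha=0$.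 $\mathcal{C}_\alpha(\mathbb{R}^n)$ is the set of all $f:\mathbb{R}^n\to[0,\infty)$ that are $\alpha$-concave, upper semicontinuous, integrable, not identically zero, with $\dim(\mathrm{supp}(f))=n$, $o\in\mathrm{supp}(f)$ (where $o$ is the origin) and $\lim_{\|x\|\to\infty}f(x)=0$. The total mass of an integrable $f$ is $J(f)=\int_{\mathbb{R}^n}f(x)\,dx$. **Inner $\alpha$-linearizations.** Let $f\in\mathcal{C}_\alpha(\mathbb{R}^n)$. Given a finite nonempty set $\mathbf{Y}=\{(x_1,s_1),\ldots,(x_M,s_M)\}$ contained in the hypograph of $f$, i.e. $0<s_i\leq f(x_i)$, put $y_i=(1-s_i^\alpha)/\alpha$ if $\alpha\neq0$ and $y_i=-\log s_i$ if $\alpha=0$, and define \[ p(x)=\min\Big\{\sum_{i=1}^M\lambda_i y_i:\ \lambda_i\geq0,\ \sum_{i=1}^M\lambda_i=1,\ \sum_{i=1}^M\lambda_i x_i=x\Big\} \] if $x\in\mathrm{conv}\{x_1,\ldots,x_M\}$, and $p(x)=+\infty$ otherwise. (This $p$ is an inner linearization of the convex base function $\mathrm{base}_\alpha f$, which equals $(1-f^\alpha)/\alpha$, or $-\log f$ if $\alpha=0$, on $\mathrm{supp}(f)$ and $+\infty$ elsewhere.) The function $q=g_\alpha\circ p$ is called an inner $\alpha$-linearization of $f$. A point $x$ is a break point of $q$ if $(x,y)$ is an extreme point of the epigraph $\mathrm{epi}(p)=\{(z,t)\in\mathbb{R}^n\times\mathbb{R}:t\geq p(z)\}$ for some $y\in\mathbb{R}$.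 $\mathscr{P}_{\alpha,N}(f)$ is the class of all inner $\alpha$-linearizations of $f$ with at most $N$ break points. **Symmetric decreasing rearrangement.** For a measurable set $A\subset\mathbb{R}^n$ of finite volume, $B_A$ is the closed Euclidean ball centered at the origin with the same volume as $A$ (with $B_A=\{o\}$ if $A$ is nonempty of volume zero, and $B_\varnothing=\varnothing$). For $f\in\mathcal{C}_\alpha(\mathbb{R}^n)$, $f^*:\mathbb{R}^n\to[0,\infty)$ is the function with $\{x: f^*(x)\geq t\}=B_{\{x:f(x)\geq t\}}$ for all $t>0$; one has $f^*\in\mathcal{C}_\alpha(\mathbb{R}^n)$. *)

theory Defs
  imports "HOL-Analysis.Analysis"
begin

definition g_fun :: "real \<Rightarrow> real \<Rightarrow> real" where
  "g_fun \<alpha> x = (if \<alpha> = 0 then exp (- x) else (max (1 - \<alpha> * x) 0) powr (1 / \<alpha>))"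

definition admissible_alphas :: "real set" where
  "admissible_alphas = {\<alpha>. strict_antimono_on {x. 1 - \<alpha> * x > 0} (g_fun \<alpha>)}"

text \<open>Extension by the value 0 at plus infinity. The value at minus infinity is irrelevant,
  since it is never attained by the functions below.\<close>

definition g_ext :: "real \<Rightarrow> ereal \<Rightarrow> real" where
  "g_ext \<alpha> y = (if \<bar>y\<bar> = \<infinity> then 0 else g_fun \<alpha> (real_of_ereal y))"

definition supp :: "('a \<Rightarrow> real) \<Rightarrow> 'a set" where
  "supp f = {x. f x \<noteq> 0}"

definition alpha_concave :: "real \<Rightarrow> ('a::euclidean_space \<Rightarrow> real) \<Rightarrow> bool" where
  "alpha_concave \<alpha> f \<longleftrightarrow> convex (supp f) \<and>
     (\<forall>x\<in>supp f. \<forall>y\<in>supp f. \<forall>l\<in>{0..1}.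
        f (l *\<^sub>R x + (1 - l) *\<^sub>R y) \<ge>
          (if \<alpha> = 0 then f x powr l * f y powr (1 - l)
           else (l * f x powr \<alpha> + (1 - l) * f y powr \<alpha>) powr (1 / \<alpha>)))"

definition upper_semicontinuous :: "('a::topological_space \<Rightarrow> real) \<Rightarrow> bool" where
  "upper_semicontinuous f \<longleftrightarrow> (\<forall>x. \<forall>t>f x. eventually (\<lambda>y. f y < t) (at x))"

definition C_class :: "real \<Rightarrow> ('a::euclidean_space \<Rightarrow> real) set" where
  "C_class \<alpha> = {f. (\<forall>x. 0 \<le> f x) \<and> alpha_concave \<alpha> f \<and> upper_semicontinuous f \<and>
     integrable lebesgue f \<and> (\<exists>x. f x \<noteq> 0) \<and> aff_dim (supp f) = int DIM('a) \<and>
     0 \<in> supp f \<and> (f \<longlongrightarrow> 0) at_infinity}"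

definition total_mass :: "('a::euclidean_space \<Rightarrow> real) \<Rightarrow> real" where
  "total_mass f = integral\<^sup>L lebesgue f"

definition base_val :: "real \<Rightarrow> real \<Rightarrow> real" where
  "base_val \<alpha> s = (if \<alpha> = 0 then - ln s else (1 - s powr \<alpha>) / \<alpha>)"

definition hypograph :: "('a \<Rightarrow> real) \<Rightarrow> ('a \<times> real) set" where
  "hypograph f = {(x, s). 0 < s \<and> s \<le> f x}"

text \<open>The weights are indexed by the points \<open>(x, s)\<close> of \<open>Y\<close> themselves. For finite \<open>Y\<close> and \<open>x\<close> in
  the convex hull, the admissible weights (restricted to \<open>Y\<close>) form a nonempty compact set on
  which the objective is continuous, so this infimum is a minimum.\<close>

definition inner_lin_base :: "real \<Rightarrow> ('a::euclidean_space \<times> real) set \<Rightarrow> 'a \<Rightarrow> ereal" where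
  "inner_lin_base \<alpha> Y x =
     (if x \<in> convex hull (fst ` Y)
      then ereal (Inf {\<Sum>z\<in>Y. l z * base_val \<alpha> (snd z) | l.
             (\<forall>z\<in>Y. 0 \<le> l z) \<and> (\<Sum>z\<in>Y. l z) = 1 \<and> (\<Sum>z\<in>Y. l z *\<^sub>R fst z) = x})
      else \<infinity>)"

definition epi :: "('a \<Rightarrow> ereal) \<Rightarrow> ('a \<times> real) set" where
  "epi p = {(z, t). p z \<le> ereal t}"

text \<open>The break points of the function \<open>g_ext \<alpha> \<circ> p\<close>. For \<open>\<alpha>\<close> in \<^const>\<open>admissible_alphas\<close> and
  \<open>p\<close> an inner linearization, \<open>p\<close> is determined by that function, by injectivity
  of \<^term>\<open>g_fun \<alpha>\<close>.\<close>

definition break_points :: "('a::euclidean_space \<Rightarrow> ereal) \<Rightarrow> 'a set" where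
  "break_points p = {x. \<exists>y. (x, y) extreme_point_of (epi p)}"

definition inner_linearizations ::
    "real \<Rightarrow> nat \<Rightarrow> ('a::euclidean_space \<Rightarrow> real) \<Rightarrow> ('a \<Rightarrow> real) set" where
  "inner_linearizations \<alpha> N f =
     {q. \<exists>Y. finite Y \<and> Y \<noteq> {} \<and> Y \<subseteq> hypograph f \<and>
             q = (\<lambda>x. g_ext \<alpha> (inner_lin_base \<alpha> Y x)) \<and>
             finite (break_points (inner_lin_base \<alpha> Y)) \<and>
             card (break_points (inner_lin_base \<alpha> Y)) \<le> N}"

definition G_functional :: "nat \<Rightarrow> real \<Rightarrow> ('a::euclidean_space \<Rightarrow> real) \<Rightarrow> real" where
  "G_functional N \<alpha> f = (INF q\<in>inner_linearizations \<alpha> N f. total_mass f - total_mass q)"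

text \<open>For a nonempty set of volume zero the radius below is 0, so the result is the origin.\<close>

definition sym_ball :: "'a::euclidean_space set \<Rightarrow> 'a set" where
  "sym_ball A =
     (if A = {} then {}
      else cball 0 (THE r. 0 \<le> r \<and> measure lebesgue (cball (0::'a) r) = measure lebesgue A))"

definition sym_rearrangement :: "('a::euclidean_space \<Rightarrow> real) \<Rightarrow> 'a \<Rightarrow> real" where
  "sym_rearrangement f =
     (THE h. (\<forall>x. 0 \<le> h x) \<and> (\<forall>t>0. {x. h x \<ge> t} = sym_ball {x. f x \<ge> t}))"

end

theory Submission
  imports Defs
begin

text \<open>
  Why a rearranged function is the hardest to approximate. Since \<open>f\<close> and its rearrangement have the
  same total mass, it suffices to find, for every inner linearization of the rearrangement, inner
  linearizations of \<open>f\<close> with no more break points and with almost as much mass. This is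
  Macbeath's argument for inscribed polytopes, carried out for all superlevel sets at once.

  An inner linearization is given by finitely many points \<open>x i\<close> with levels \<open>s i\<close>. Keep the levels
  fixed and regard the mass as a function of the \<open>x i\<close>. If all points move parallel to one line, the
  mass is a convex function of the displacements (\<open>mass_midpoint_le\<close>): a superlevel set is a
  projection of a slice of a convex hull, and on each line parallel to the motion the length of
  the projection is a maximum minus a minimum of functions that are linear in the displacements.
  The mass is also invariant under reflections. A point of the Steiner symmetral of a convex set \<open>K\<close>
  in direction \<open>u\<close> is the midpoint of a point \<open>a\<close> of \<open>K\<close> and of the mirror image of a point \<open>b\<close>
  of \<open>K\<close>, where \<open>a\<close> and \<open>b\<close> lie on a common line parallel to \<open>u\<close>. Hence points chosen in the
  symmetrals of sets \<open>K i\<close> can be replaced by points of the \<open>K i\<close> themselves, all the \<open>a\<close> or all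
  the \<open>b\<close>, without loss of mass (\<open>mass_le_steiner\<close>).

  Finitely many Steiner symmetrizations, applied to finitely many convex bodies simultaneously,
  make each of them contain any prescribed smaller copy of the ball of the same volume
  (\<open>simultaneous_rounding\<close>). The potential is the sum of the circumradii, taken about the origin. A convex body that misses
  part of a slightly smaller ball misses a whole cap of its circumscribed ball; reflections carry
  the missing cap all over the sphere, so suitable symmetrizations shrink the circumradius by a
  factor that depends only on the size of the cap. Near the infimum of the potential this is impossible.

  These facts are applied to the superlevel sets of \<open>f\<close> at the levels \<open>c * s i\<close> with \<open>c < 1\<close>.
  They are convex bodies even if the superlevel set at \<open>s i\<close> has volume zero, and the points
  \<open>c *\<^sub>R x i\<close> lie in their slightly shrunken balls. Scaling points and levels by \<open>c\<close>
  multiplies the mass by a power of \<open>c\<close> (\<open>mass_scale\<close>), so that the loss disappears as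
  \<open>c\<close> tends to 1. Finally, an inner linearization is generated by the points above its break points
  (\<open>break_points_reduce\<close>), so that the bound on the number of break points may be replaced by a bound
  on the number of generating points.
\<close>

section \<open>Integration along parallel lines\<close>

text \<open>Tonelli for the lines parallel to \<open>u\<close>, without splitting the space into a product: integrating over
  a slab of width 1 hits each line in a segment of length 1, so each point of \<open>A\<close> is counted with
  weight 1. The only tool is translation invariance, and \<open>u\<close> may be any unit vector.\<close>

lemma emeasure_by_lines:
  fixes A :: "'a::euclidean_space set" and u :: 'a
  assumes A [measurable]: "A \<in> sets borel" and u: "norm u = 1"
  shows "emeasure lborel A =
    (\<integral>\<^sup>+x. indicator {x. 0 \<le> x \<bullet> u \<and> x \<bullet> u < 1} x * emeasure lborel {t. x + t *\<^sub>R u \<in> A} \<partial>lborel)"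
proof -
  have uu: "u \<bullet> u = 1" using u by (simp add: dot_square_norm)
  let ?S = "{x::'a. 0 \<le> x \<bullet> u \<and> x \<bullet> u < 1}"
  have "(\<integral>\<^sup>+x. indicator ?S x * emeasure lborel {t. x + t *\<^sub>R u \<in> A} \<partial>lborel)
      = (\<integral>\<^sup>+x. (\<integral>\<^sup>+t. indicator ?S x * indicator A (x + t *\<^sub>R u) \<partial>lborel) \<partial>lborel)"
  proof (rule nn_integral_cong)
    fix x :: 'a
    have "emeasure lborel {t. x + t *\<^sub>R u \<in> A} = (\<integral>\<^sup>+t. indicator {t. x + t *\<^sub>R u \<in> A} t \<partial>lborel)"
      by (subst nn_integral_indicator) auto
    then show "indicator ?S x * emeasure lborel {t. x + t *\<^sub>R u \<in> A}
        = (\<integral>\<^sup>+t. indicator ?S x * indicator A (x + t *\<^sub>R u) \<partial>lborel)"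
      by (subst nn_integral_cmult) (auto simp: indicator_def)
  qed
  also have "\<dots> = (\<integral>\<^sup>+t. (\<integral>\<^sup>+x. indicator ?S x * indicator A (x + t *\<^sub>R u) \<partial>lborel) \<partial>lborel)"
    by (rule lborel_pair.Fubini'[symmetric]) simp
  also have "\<dots> = (\<integral>\<^sup>+t. (\<integral>\<^sup>+x. indicator ?S (x - t *\<^sub>R u) * indicator A x \<partial>lborel) \<partial>lborel)"
  proof (rule nn_integral_cong)
    fix t :: real
    show "(\<integral>\<^sup>+x. indicator ?S x * indicator A (x + t *\<^sub>R u) \<partial>lborel)
      = (\<integral>\<^sup>+x. indicator ?S (x - t *\<^sub>R u) * indicator A x \<partial>lborel)"
      by (subst (2) lborel_distr_plus[of "t *\<^sub>R u", symmetric], subst nn_integral_distr)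
         (auto simp: add.commute)
  qed
  also have "\<dots> = (\<integral>\<^sup>+x. (\<integral>\<^sup>+t. indicator ?S (x - t *\<^sub>R u) * indicator A x \<partial>lborel) \<partial>lborel)"
    by (rule lborel_pair.Fubini') simp
  also have "\<dots> = (\<integral>\<^sup>+x. indicator A x \<partial>lborel)"
  proof (rule nn_integral_cong)
    fix x :: 'a
    have "(\<integral>\<^sup>+t. indicator ?S (x - t *\<^sub>R u) * indicator A x \<partial>lborel)
      = (\<integral>\<^sup>+t. indicator {x \<bullet> u - 1 <.. x \<bullet> u} t * indicator A x \<partial>lborel)"
      by (rule nn_integral_cong) (auto simp: indicator_def inner_diff_left uu)
    also have "\<dots> = indicator A x"
      by (subst nn_integral_multc) (auto simp: algebra_simps)
    finally show "(\<integral>\<^sup>+t. indicator ?S (x - t *\<^sub>R u) * indicator A x \<partial>lborel) = indicator A x" .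
  qed
  finally show ?thesis by (simp)
qed

lemma compact_imp_borel [measurable_dest]:
  "compact A \<Longrightarrow> A \<in> sets (borel :: 'a::t2_space measure)"
  by (simp add: borel_closed compact_imp_closed)

lemma compact_line_slice:
  fixes A :: "'a::euclidean_space set"
  assumes "compact A" and u: "norm u = 1"
  shows "compact {t. x + t *\<^sub>R u \<in> A}"
proof -
  have "closed ((\<lambda>t. x + t *\<^sub>R u) -` A)"
    by (intro continuous_closed_vimage compact_imp_closed assms) (auto intro!: continuous_intros)
  moreover obtain r where r: "\<And>a. a \<in> A \<Longrightarrow> norm a \<le> r"
    using compact_imp_bounded[OF assms(1)] unfolding bounded_iff by blast
  have "norm t \<le> r + norm x" if "x + t *\<^sub>R u \<in> A" for t
    using r[OF that] norm_triangle_ineq4[of "x + t *\<^sub>R u" x] u by simp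
  then have "bounded {t. x + t *\<^sub>R u \<in> A}" unfolding bounded_iff by blast
  ultimately show ?thesis by (simp add: vimage_def compact_eq_bounded_closed)
qed

lemma compact_convex_real:
  fixes T :: "real set"
  assumes "compact T" "convex T" "T \<noteq> {}"
  obtains a b where "a \<le> b" "T = {a..b}"
proof -
  have "connected T" using assms convex_connected by blast
  with assms obtain a b where "T = {a..b}" using connected_compact_interval_1 by metis
  with assms that show ?thesis by fastforce
qed

text \<open>The set of midpoints lies in the interval whose end points are the means of the end points of the
  two projections, which are intervals.\<close>

lemma midpoint_length_le:
  fixes F :: "(real \<times> real) set"
  assumes "compact F" "convex F"
  shows "2 * emeasure lborel ((\<lambda>(s, t). (s + t) / 2) ` F) \<le> emeasure lborel (fst ` F) + emeasure lborel (snd ` F)"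
proof (cases "F = {}")
  case False
  have "compact (fst ` F)" "compact (snd ` F)"
    by (auto intro!: compact_continuous_image continuous_intros assms)
  moreover have "convex (fst ` F)" "convex (snd ` F)"
    using assms convex_linear_image linear_fst linear_snd by blast+
  ultimately obtain a b c d where ab: "a \<le> b" "fst ` F = {a..b}" and cd: "c \<le> d" "snd ` F = {c..d}"
    using False compact_convex_real[of "fst ` F"] compact_convex_real[of "snd ` F"] by (metis image_is_empty)
  have "(\<lambda>(s, t). (s + t) / 2) ` F \<subseteq> {(a + c)/2..(b + d)/2}"
  proof
    fix z assume "z \<in> (\<lambda>(s, t). (s + t) / 2) ` F"
    then obtain s t where st: "(s, t) \<in> F" "z = (s + t) / 2" by auto
    then have "s \<in> {a..b}" "t \<in> {c..d}" using ab cd by force+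
    then show "z \<in> {(a + c)/2..(b + d)/2}" using st by auto
  qed
  then have "emeasure lborel ((\<lambda>(s, t). (s + t) / 2) ` F) \<le> emeasure lborel {(a + c)/2..(b + d)/2}"
    by (intro emeasure_mono) auto
  also have "\<dots> = ennreal ((b + d) / 2 - (a + c)/2)"
    using ab cd by (intro emeasure_lborel_Icc) auto
  finally have "2 * emeasure lborel ((\<lambda>(s, t). (s + t) / 2) ` F) \<le> 2 * ennreal ((b + d) / 2 - (a + c)/2)"
    by (rule mult_left_mono) simp
  also have "\<dots> = ennreal (2 * ((b + d) / 2 - (a + c)/2))"
    using ab cd by (subst ennreal_mult) auto
  also have "\<dots> = ennreal ((b - a) + (d - c))"
    by (intro arg_cong[where f=ennreal]) (simp add: field_simps)
  also have "\<dots> = emeasure lborel (fst ` F) + emeasure lborel (snd ` F)"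
    unfolding ab cd using ab cd by simp
  finally show ?thesis .
qed simp

text \<open>Convexity of volume along a parallel motion. One may think of \<open>E\<close> as a set of particles, each with
  an initial and a final position on a common line parallel to \<open>u\<close>; half-way, the particles occupy
  at most the mean of the two volumes. Each line is treated by \<open>midpoint_length_le\<close>.\<close>

lemma emeasure_midpoint_parallel_le:
  fixes E :: "('a::euclidean_space \<times> 'a) set"
  assumes E: "compact E" "convex E" and u: "norm u = 1"
    and par: "\<And>a b. (a, b) \<in> E \<Longrightarrow> \<exists>c. a - b = c *\<^sub>R u"
  shows "2 * emeasure lborel ((\<lambda>(a, b). (1/2) *\<^sub>R (a + b)) ` E) \<le> emeasure lborel (fst ` E) + emeasure lborel (snd ` E)"
proof -
  let ?M = "(\<lambda>(a, b). (1/2::real) *\<^sub>R (a + b)) ` E"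
  let ?S = "{x::'a. 0 \<le> x \<bullet> u \<and> x \<bullet> u < 1}"
  have cpt: "compact ?M" "compact (fst ` E)" "compact (snd ` E)"
    unfolding case_prod_unfold by (auto intro!: compact_continuous_image continuous_intros E)
  note [measurable] = cpt[THEN compact_imp_borel]
  have pw: "2 * emeasure lborel {t. x + t *\<^sub>R u \<in> ?M} \<le> emeasure lborel {t. x + t *\<^sub>R u \<in> fst ` E}
          + emeasure lborel {t. x + t *\<^sub>R u \<in> snd ` E}" for x
  proof -
    \<comment> \<open>\<open>F\<close> collects the particles travelling on the line through \<open>x\<close>, in the coordinate along \<open>u\<close>.\<close>
    define h where "h = (\<lambda>(s::real, t::real). (x + s *\<^sub>R u, x + t *\<^sub>R u))"
    define F where "F = h -` E"
    have clF: "closed F" unfolding F_def h_def case_prod_unfold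
      by (intro continuous_closed_vimage compact_imp_closed E) (auto intro!: continuous_intros)
    have sub: "F \<subseteq> {t. x + t *\<^sub>R u \<in> fst ` E} \<times> {t. x + t *\<^sub>R u \<in> snd ` E}"
      unfolding F_def h_def by force
    have "compact ({t. x + t *\<^sub>R u \<in> fst ` E} \<times> {t. x + t *\<^sub>R u \<in> snd ` E})"
      by (intro compact_Times compact_line_slice cpt u)
    then have "compact F" using clF sub by (metis compact_Int_closed inf.absorb_iff2)
    have "convex F"
    proof (rule convexI)
      fix p q :: "real \<times> real" and k l :: real
      assume pq: "p \<in> F" "q \<in> F" and kl: "0 \<le> k" "0 \<le> l" "k + l = 1"
      have "h (k *\<^sub>R p + l *\<^sub>R q) = k *\<^sub>R h p + l *\<^sub>R h q"
      proof -
        have "x = k *\<^sub>R x + l *\<^sub>R x" using kl by (metis scaleR_left_distrib scaleR_one)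
        then show ?thesis
          by (cases p; cases q) (simp add: h_def algebra_simps)
      qed
      also have "\<dots> \<in> E" using pq kl E(2) unfolding F_def by (auto intro: convexD)
      finally show "k *\<^sub>R p + l *\<^sub>R q \<in> F" unfolding F_def by simp
    qed
    have "{t. x + t *\<^sub>R u \<in> ?M} \<subseteq> (\<lambda>(s, t). (s + t) / 2) ` F"
    proof
      fix t assume "t \<in> {t. x + t *\<^sub>R u \<in> ?M}"
      then obtain a b where ab: "(a, b) \<in> E" "x + t *\<^sub>R u = (1/2::real) *\<^sub>R (a + b)" by auto
      obtain c where c: "a - b = c *\<^sub>R u" using par ab by blast
      have "a = (1/2::real) *\<^sub>R (a + b) + (1/2::real) *\<^sub>R (a - b)"
           "b = (1/2::real) *\<^sub>R (a + b) - (1/2::real) *\<^sub>R (a - b)"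
        by (simp_all add: algebra_simps flip: scaleR_left_distrib)
      then have "a = x + (t + c/2) *\<^sub>R u" "b = x + (t - c/2) *\<^sub>R u"
        unfolding ab(2)[symmetric] c by (simp_all add: algebra_simps)
      then have "(t + c/2, t - c/2) \<in> F" using ab(1) by (simp add: F_def h_def)
      then show "t \<in> (\<lambda>(s, t). (s + t) / 2) ` F" by (force intro!: image_eqI)
    qed
    moreover have "(\<lambda>(s::real, t). (s + t) / 2) ` F \<in> sets lborel"
    proof -
      have "compact ((\<lambda>(s::real, t). (s + t) / 2) ` F)"
        unfolding case_prod_unfold by (auto intro!: compact_continuous_image continuous_intros \<open>compact F\<close>)
      then show ?thesis by (simp add: compact_imp_borel)
    qed
    ultimately have "2 * emeasure lborel {t. x + t *\<^sub>R u \<in> ?M} \<le> 2 * emeasure lborel ((\<lambda>(s, t). (s + t) / 2) ` F)"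
      by (intro mult_left_mono emeasure_mono) auto
    also have "\<dots> \<le> emeasure lborel (fst ` F) + emeasure lborel (snd ` F)"
      by (rule midpoint_length_le) fact+
    also have "\<dots> \<le> emeasure lborel {t. x + t *\<^sub>R u \<in> fst ` E} + emeasure lborel {t. x + t *\<^sub>R u \<in> snd ` E}"
      using sub by (intro add_mono emeasure_mono) (auto intro!: compact_imp_borel compact_line_slice cpt u)
    finally show ?thesis .
  qed
  have mA [measurable]: "(\<lambda>x. emeasure lborel {t. x + t *\<^sub>R u \<in> A}) \<in> borel_measurable (borel :: 'a measure)"
    if [measurable]: "A \<in> sets borel" for A
  proof -
    have "{p \<in> space (lborel \<Otimes>\<^sub>M lborel). fst p + snd p *\<^sub>R u \<in> A} \<in> sets (lborel \<Otimes>\<^sub>M (lborel :: real measure))"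
      by measurable
    from lborel.measurable_emeasure_Pair[OF this] show ?thesis
      by (simp add: vimage_def space_pair_measure)
  qed
  have "2 * emeasure lborel ?M = (\<integral>\<^sup>+x. indicator ?S x * (2 * emeasure lborel {t. x + t *\<^sub>R u \<in> ?M}) \<partial>lborel)"
    by (subst emeasure_by_lines[OF _ u], simp, subst nn_integral_cmult[symmetric]) (auto simp: mult_ac)
  also have "\<dots> \<le> (\<integral>\<^sup>+x. indicator ?S x * (emeasure lborel {t. x + t *\<^sub>R u \<in> fst ` E}
          + emeasure lborel {t. x + t *\<^sub>R u \<in> snd ` E}) \<partial>lborel)"
    by (intro nn_integral_mono mult_left_mono pw) auto
  also have "\<dots> = emeasure lborel (fst ` E) + emeasure lborel (snd ` E)"
    unfolding distrib_left
    by (subst nn_integral_add) (auto simp: emeasure_by_lines[OF _ u, symmetric])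
  finally show ?thesis .
qed

section \<open>Inner linearizations through their superlevel sets\<close>

lemma base_val_le_iff:
  assumes "0 < s" "0 < t"
  shows "base_val \<alpha> s \<le> base_val \<alpha> t \<longleftrightarrow> t \<le> s"
proof -
  consider "\<alpha> = 0" | "\<alpha> > 0" | "\<alpha> < 0" by linarith
  then show ?thesis
  proof cases
    case 1
    then show ?thesis using assms by (simp add: base_val_def)
  next
    case 2
    then have "base_val \<alpha> s \<le> base_val \<alpha> t \<longleftrightarrow> t powr \<alpha> \<le> s powr \<alpha>"
      by (simp add: base_val_def field_simps)
    also have "\<dots> \<longleftrightarrow> t \<le> s" using 2 assms powr_mono2[of \<alpha> t s] powr_less_mono2[of \<alpha> s t] by fastforce
    finally show ?thesis .
  next
    case 3
    then have "base_val \<alpha> s \<le> base_val \<alpha> t \<longleftrightarrow> s powr \<alpha> \<le> t powr \<alpha>"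
      by (simp add: base_val_def field_simps)
    also have "\<dots> \<longleftrightarrow> t \<le> s" using 3 assms powr_mono2'[of \<alpha> t s] powr_less_mono2_neg[of \<alpha> s t] by fastforce
    finally show ?thesis .
  qed
qed

lemma base_val_eq_iff: "0 < s \<Longrightarrow> 0 < t \<Longrightarrow> base_val \<alpha> s = base_val \<alpha> t \<longleftrightarrow> s = t"
  by (metis base_val_le_iff order_antisym order_refl)

lemma base_val_domain: "0 < s \<Longrightarrow> 0 < 1 - \<alpha> * base_val \<alpha> s"
  by (simp add: base_val_def)

lemma base_val_g_fun:
  assumes "0 < 1 - \<alpha> * y"
  shows "0 < g_fun \<alpha> y" "base_val \<alpha> (g_fun \<alpha> y) = y"
  using assms by (auto simp: g_fun_def base_val_def powr_powr)

text \<open>On the domain of strict monotonicity, \<^term>\<open>g_fun \<alpha>\<close> and \<^term>\<open>base_val \<alpha>\<close> are mutually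
  inverse and decreasing. Apart from nonnegativity, this equivalence is all that later arguments
  need to know about \<^term>\<open>g_fun \<alpha>\<close>.\<close>

lemma le_g_fun_iff:
  assumes "0 < 1 - \<alpha> * y" "0 < t"
  shows "t \<le> g_fun \<alpha> y \<longleftrightarrow> y \<le> base_val \<alpha> t"
  using base_val_le_iff[of "g_fun \<alpha> y" t \<alpha>] base_val_g_fun[OF assms(1)] assms(2) by simp

text \<open>Multiplying the values of a function by \<open>c\<close> acts on its base function by an affine map with positive
  slope.\<close>

lemma base_val_mult:
  assumes "0 < c" "0 < s"
  shows "base_val \<alpha> (c * s) = base_val \<alpha> c + c powr \<alpha> * base_val \<alpha> s"
  using assms by (auto simp: base_val_def ln_mult powr_mult field_simps)

definition base_points :: "real \<Rightarrow> ('a \<times> real) set \<Rightarrow> ('a \<times> real) set" where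
  "base_points \<alpha> Y = (\<lambda>(x, s). (x, base_val \<alpha> s)) ` Y"

definition inner_lin :: "real \<Rightarrow> ('a::euclidean_space \<times> real) set \<Rightarrow> 'a \<Rightarrow> real" where
  "inner_lin \<alpha> Y = (\<lambda>x. g_ext \<alpha> (inner_lin_base \<alpha> Y x))"

text \<open>The points \<open>(x, s)\<close> that generate an inner linearization. Positivity of \<open>s\<close> keeps the base values
  inside the domain on which \<^term>\<open>g_fun \<alpha>\<close> is strictly decreasing.\<close>

locale hypo_points =
  fixes Y :: "('a::euclidean_space \<times> real) set"
  assumes finite: "finite Y" and nonempty: "Y \<noteq> {}" and pos: "\<And>x s. (x, s) \<in> Y \<Longrightarrow> 0 < s"
begin

lemma inj_on_base: "inj_on (\<lambda>(x, s). (x, base_val \<alpha> s)) Y"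
  using pos by (auto simp: inj_on_def base_val_eq_iff)

lemma fst_base_points: "fst ` base_points \<alpha> Y = fst ` Y"
  by (force simp: base_points_def)

lemma fst_hull_base_points: "fst ` (convex hull base_points \<alpha> Y) = convex hull (fst ` Y)"
  by (simp add: convex_hull_linear_image linear_fst fst_base_points)

lemma compact_hull_base_points: "compact (convex hull base_points \<alpha> Y)"
  by (simp add: base_points_def finite finite_imp_compact_convex_hull)

lemma hull_base_points_domain: "(x, y) \<in> convex hull base_points \<alpha> Y \<Longrightarrow> 0 < 1 - \<alpha> * y"
proof -
  have "convex {p :: 'a \<times> real. \<alpha> * snd p < 1}"
  proof -
    have "{p :: 'a \<times> real. \<alpha> * snd p < 1} = {p. (0, \<alpha>) \<bullet> p < 1}" by (auto simp: inner_prod_def)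
    then show ?thesis by (simp add: convex_halfspace_lt)
  qed
  moreover have "base_points \<alpha> Y \<subseteq> {p. \<alpha> * snd p < 1}"
    using base_val_domain pos by (fastforce simp: base_points_def)
  ultimately have "convex hull base_points \<alpha> Y \<subseteq> {p. \<alpha> * snd p < 1}" by (rule hull_minimal[rotated])
  then show "(x, y) \<in> convex hull base_points \<alpha> Y \<Longrightarrow> 0 < 1 - \<alpha> * y" by auto
qed

text \<open>The weights are indexed by \<open>Y\<close>, whereas the elements of a convex hull are described by weights
  indexed by the lifted points. Injectivity of the lifting translates between the two.\<close>

lemma inner_lin_base_weights:
  "{\<Sum>z\<in>Y. l z * base_val \<alpha> (snd z) | l.
      (\<forall>z\<in>Y. 0 \<le> l z) \<and> (\<Sum>z\<in>Y. l z) = 1 \<and> (\<Sum>z\<in>Y. l z *\<^sub>R fst z) = x}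
   = {y. (x, y) \<in> convex hull base_points \<alpha> Y}" (is "?L = ?R")
proof -
  let ?h = "\<lambda>(x::'a, s). (x, base_val \<alpha> s)"
  have sum: "(\<Sum>z\<in>Y. l z *\<^sub>R ?h z) = (\<Sum>z\<in>Y. l z *\<^sub>R fst z, \<Sum>z\<in>Y. l z * base_val \<alpha> (snd z))" for l
    by (simp add: prod_eq_iff fst_sum snd_sum case_prod_unfold)
  have inj: "inj_on ?h Y" by (rule inj_on_base)
  have hull: "convex hull base_points \<alpha> Y
     = {y. \<exists>u. (\<forall>z\<in>Y. 0 \<le> u (?h z)) \<and> (\<Sum>z\<in>Y. u (?h z)) = 1 \<and> (\<Sum>z\<in>Y. u (?h z) *\<^sub>R ?h z) = y}"
    unfolding base_points_def
    by (subst convex_hull_finite) (auto simp: finite sum.reindex[OF inj] o_def)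
  show ?thesis
  proof (intro equalityI subsetI)
    fix y assume "y \<in> ?L"
    then obtain l where l: "\<forall>z\<in>Y. 0 \<le> l z" "sum l Y = 1" "(\<Sum>z\<in>Y. l z *\<^sub>R fst z) = x"
        "y = (\<Sum>z\<in>Y. l z * base_val \<alpha> (snd z))" by blast
    define u where "u = l \<circ> inv_into Y ?h"
    have u: "u (?h z) = l z" if "z \<in> Y" for z
      unfolding u_def o_def using inv_into_f_f[OF inj that] by simp
    have "(\<forall>z\<in>Y. 0 \<le> u (?h z)) \<and> (\<Sum>z\<in>Y. u (?h z)) = 1 \<and> (\<Sum>z\<in>Y. u (?h z) *\<^sub>R ?h z) = (x, y)"
      using l sum[of l] by (simp add: u cong: sum.cong)
    then show "y \<in> ?R" unfolding hull by blast
  next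
    fix y assume "y \<in> ?R"
    then obtain u where u: "\<forall>z\<in>Y. 0 \<le> u (?h z)" "(\<Sum>z\<in>Y. u (?h z)) = 1" "(\<Sum>z\<in>Y. u (?h z) *\<^sub>R ?h z) = (x, y)"
      unfolding hull by blast
    then show "y \<in> ?L"
      using sum[of "\<lambda>z. u (?h z)"] by (auto intro!: exI[of _ "\<lambda>z. u (?h z)"])
  qed
qed

lemma inner_lin_base_attained:
  assumes "x \<in> convex hull (fst ` Y)"
  obtains y where "inner_lin_base \<alpha> Y x = ereal y" "(x, y) \<in> convex hull base_points \<alpha> Y"
    "\<And>z. (x, z) \<in> convex hull base_points \<alpha> Y \<Longrightarrow> y \<le> z"
proof -
  let ?R = "{y. (x, y) \<in> convex hull base_points \<alpha> Y}"
  have ne: "?R \<noteq> {}" using assms unfolding fst_hull_base_points[of \<alpha>, symmetric] by force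
  have "closed (Pair x -` (convex hull base_points \<alpha> Y))"
    by (intro continuous_closed_vimage compact_imp_closed compact_hull_base_points) (auto intro!: continuous_intros)
  then have cl: "closed ?R" by (simp add: vimage_def)
  have "?R \<subseteq> snd ` (convex hull base_points \<alpha> Y)" by force
  then have "bounded ?R"
    using bounded_snd compact_imp_bounded[OF compact_hull_base_points] bounded_subset by blast
  then have bd: "bdd_below ?R" by (rule bounded_imp_bdd_below)
  have "inner_lin_base \<alpha> Y x = ereal (Inf ?R)"
    using assms by (simp add: inner_lin_base_def inner_lin_base_weights)
  moreover have "Inf ?R \<in> ?R" using ne bd cl by (rule closed_contains_Inf)
  moreover have "Inf ?R \<le> z" if "(x, z) \<in> convex hull base_points \<alpha> Y" for z
    using that by (intro cInf_lower bd) simp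
  ultimately show ?thesis using that by blast
qed

lemma inner_lin_base_le_iff:
  "inner_lin_base \<alpha> Y x \<le> ereal t \<longleftrightarrow> (\<exists>y\<le>t. (x, y) \<in> convex hull base_points \<alpha> Y)"
proof (cases "x \<in> convex hull (fst ` Y)")
  case True
  from inner_lin_base_attained[OF this, of \<alpha>] show ?thesis by (metis ereal_less_eq(3) order_trans)
next
  case False
  then have "\<nexists>y. (x, y) \<in> convex hull base_points \<alpha> Y"
    unfolding fst_hull_base_points[of \<alpha>, symmetric] by force
  with False show ?thesis by (auto simp: inner_lin_base_def)
qed

lemma le_inner_lin_iff:
  assumes "0 < t"
  shows "t \<le> inner_lin \<alpha> Y x \<longleftrightarrow> (\<exists>y\<le>base_val \<alpha> t. (x, y) \<in> convex hull base_points \<alpha> Y)"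
proof (cases "x \<in> convex hull (fst ` Y)")
  case True
  from inner_lin_base_attained[OF this, of \<alpha>] obtain y where y: "inner_lin_base \<alpha> Y x = ereal y"
    "(x, y) \<in> convex hull base_points \<alpha> Y" "\<And>z. (x, z) \<in> convex hull base_points \<alpha> Y \<Longrightarrow> y \<le> z" by metis
  have "t \<le> inner_lin \<alpha> Y x \<longleftrightarrow> t \<le> g_fun \<alpha> y" by (simp add: inner_lin_def g_ext_def y)
  also have "\<dots> \<longleftrightarrow> y \<le> base_val \<alpha> t" using hull_base_points_domain[OF y(2)] assms by (rule le_g_fun_iff)
  finally show ?thesis using y by (meson order_trans)
next
  case False
  then have "\<nexists>y. (x, y) \<in> convex hull base_points \<alpha> Y"
    unfolding fst_hull_base_points[of \<alpha>, symmetric] by force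
  with False assms show ?thesis by (auto simp: inner_lin_def inner_lin_base_def g_ext_def)
qed

text \<open>The link with convex geometry: a superlevel set is the shadow of a truncated polytope.\<close>

lemma inner_lin_superlevel:
  "0 < t \<Longrightarrow> {x. t \<le> inner_lin \<alpha> Y x} = fst ` (convex hull base_points \<alpha> Y \<inter> {p. snd p \<le> base_val \<alpha> t})"
  by (force simp: le_inner_lin_iff)

lemma compact_inner_lin_superlevel: "0 < t \<Longrightarrow> compact {x. t \<le> inner_lin \<alpha> Y x}"
  unfolding inner_lin_superlevel
  by (intro compact_continuous_image continuous_intros compact_Int_closed compact_hull_base_points
        closed_Collect_le)

end

lemma inner_lin_nonneg: "0 \<le> inner_lin \<alpha> Y x"
  by (simp add: inner_lin_def g_ext_def g_fun_def)

lemma borel_measurable_of_superlevels: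
  fixes h :: "'a::topological_space \<Rightarrow> real"
  assumes "\<And>x. 0 \<le> h x" "\<And>t. 0 < t \<Longrightarrow> {x. t \<le> h x} \<in> sets borel"
  shows "h \<in> borel_measurable borel"
proof -
  have "{x. t \<le> h x} \<in> sets borel" for t
  proof (cases "0 < t")
    case False
    then have "{x. t \<le> h x} = UNIV" using assms(1) by (auto intro: order_trans[of _ 0])
    then show ?thesis by simp
  qed (use assms in auto)
  then show ?thesis by (simp add: borel_measurable_iff_ge)
qed

text \<open>Tonelli on the region below the graph of \<open>h\<close>.\<close>

lemma nn_integral_layer_cake:
  fixes h :: "'a::euclidean_space \<Rightarrow> real"
  assumes nonneg: "\<And>x. 0 \<le> h x" and [measurable]: "h \<in> borel_measurable borel"
  shows "(\<integral>\<^sup>+x. h x \<partial>lborel) = (\<integral>\<^sup>+t. indicator {0<..} t * emeasure lborel {x. t \<le> h x} \<partial>lborel)"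
proof -
  have "(\<integral>\<^sup>+x. h x \<partial>lborel) = (\<integral>\<^sup>+x. (\<integral>\<^sup>+t. indicator {0<..} t * indicator {x. t \<le> h x} x \<partial>lborel) \<partial>lborel)"
  proof (rule nn_integral_cong)
    fix x
    have "(\<integral>\<^sup>+t. indicator {0<..} t * indicator {x. t \<le> h x} x \<partial>lborel) = (\<integral>\<^sup>+t. indicator {0<..h x} t \<partial>lborel)"
      by (rule nn_integral_cong) (auto simp: indicator_def)
    then show "ennreal (h x) = (\<integral>\<^sup>+t. indicator {0<..} t * indicator {x. t \<le> h x} x \<partial>lborel)"
      using nonneg[of x] by simp
  qed
  also have "\<dots> = (\<integral>\<^sup>+t. (\<integral>\<^sup>+x. indicator {0<..} t * indicator {x. t \<le> h x} x \<partial>lborel) \<partial>lborel)"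
    by (rule lborel_pair.Fubini') simp
  also have "\<dots> = (\<integral>\<^sup>+t. indicator {0<..} t * emeasure lborel {x. t \<le> h x} \<partial>lborel)"
    by (intro nn_integral_cong, subst nn_integral_cmult) auto
  finally show ?thesis .
qed

lemma total_mass_eq_nn_integral:
  fixes h :: "'a::euclidean_space \<Rightarrow> real"
  assumes "\<And>x. 0 \<le> h x" "h \<in> borel_measurable borel"
  shows "total_mass h = enn2real (\<integral>\<^sup>+x. h x \<partial>lborel)"
  unfolding total_mass_def using assms
  by (subst integral_eq_nn_integral) (auto simp: nn_integral_completion measurable_completion)

lemma total_mass_cong_superlevels:
  fixes h k :: "'a::euclidean_space \<Rightarrow> real"
  assumes "\<And>x. 0 \<le> h x" "h \<in> borel_measurable borel" "\<And>x. 0 \<le> k x" "k \<in> borel_measurable borel"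
    and "\<And>t. 0 < t \<Longrightarrow> emeasure lborel {x. t \<le> h x} = emeasure lborel {x. t \<le> k x}"
  shows "total_mass h = total_mass k"
  using assms
  by (auto simp: total_mass_eq_nn_integral nn_integral_layer_cake indicator_def
      intro!: arg_cong[where f=enn2real] nn_integral_cong)

context hypo_points begin

lemma borel_measurable_inner_lin [measurable]: "inner_lin \<alpha> Y \<in> borel_measurable borel"
  by (rule borel_measurable_of_superlevels)
     (auto simp: inner_lin_nonneg compact_inner_lin_superlevel compact_imp_borel)

lemma nn_integral_inner_lin_finite: "(\<integral>\<^sup>+x. inner_lin \<alpha> Y x \<partial>lborel) < \<infinity>"
proof -
  \<comment> \<open>An inner linearization is bounded by its highest level and vanishes outside a polytope.\<close>
  define S where "S = Max (snd ` Y)"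
  have S: "s \<le> S" if "(x, s) \<in> Y" for x s unfolding S_def using that finite by (force intro: Max_ge)
  have "0 < S" using nonempty pos S by (metis equals0I less_le_trans surj_pair)
  let ?K = "convex hull (fst ` Y)"
  have "inner_lin \<alpha> Y x \<le> S * indicator ?K x" for x
  proof (cases "x \<in> ?K")
    case True
    have le: "inner_lin \<alpha> Y x \<le> S"
    proof (rule ccontr)
      assume "\<not> inner_lin \<alpha> Y x \<le> S"
      then have gt: "S < inner_lin \<alpha> Y x" by simp
      with \<open>0 < S\<close> obtain y where y: "y \<le> base_val \<alpha> (inner_lin \<alpha> Y x)" "(x, y) \<in> convex hull base_points \<alpha> Y"
        by (metis le_inner_lin_iff less_trans order_refl)
      have "convex {p :: 'a \<times> real. base_val \<alpha> S \<le> snd p}"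
      proof -
        have "{p :: 'a \<times> real. base_val \<alpha> S \<le> snd p} = {p. (0, 1) \<bullet> p \<ge> base_val \<alpha> S}"
          by (auto simp: inner_prod_def)
        then show ?thesis by (simp add: convex_halfspace_ge)
      qed
      moreover have "base_points \<alpha> Y \<subseteq> {p. base_val \<alpha> S \<le> snd p}"
        using S pos \<open>0 < S\<close> by (auto simp: base_points_def base_val_le_iff)
      ultimately have "base_val \<alpha> S \<le> y" using y(2) hull_minimal by fastforce
      with y(1) have "base_val \<alpha> S \<le> base_val \<alpha> (inner_lin \<alpha> Y x)" by simp
      then show False using gt \<open>0 < S\<close> by (subst (asm) base_val_le_iff) auto
    qed
    then show ?thesis using True by simp
  qed (simp add: inner_lin_def inner_lin_base_def g_ext_def)
  then have "(\<integral>\<^sup>+x. inner_lin \<alpha> Y x \<partial>lborel) \<le> (\<integral>\<^sup>+x. S * indicator ?K x \<partial>lborel)"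
    by (intro nn_integral_mono ennreal_leI) auto
  also have "\<dots> = S * emeasure lborel ?K"
  proof -
    have "ennreal (S * indicator ?K x) = ennreal S * indicator ?K x" for x by (simp add: indicator_def)
    moreover have "?K \<in> sets borel" by (simp add: finite finite_imp_compact_convex_hull compact_imp_borel)
    ultimately show ?thesis by (simp add: nn_integral_cmult)
  qed
  also have "\<dots> < \<infinity>"
    using emeasure_bounded_finite[of ?K]
    by (simp add: ennreal_mult_less_top finite finite_imp_compact_convex_hull compact_imp_bounded)
  finally show ?thesis .
qed

lemma ennreal_total_mass_inner_lin: "ennreal (total_mass (inner_lin \<alpha> Y)) = (\<integral>\<^sup>+x. inner_lin \<alpha> Y x \<partial>lborel)"
  using nn_integral_inner_lin_finite[of \<alpha>]
  by (simp add: total_mass_eq_nn_integral inner_lin_nonneg)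

end

section \<open>Moving the points of an inner linearization\<close>

definition reflect :: "'a::euclidean_space \<Rightarrow> 'a \<Rightarrow> 'a" where
  "reflect u x = x - (2 * (x \<bullet> u)) *\<^sub>R u"

lemma linear_reflect: "linear (reflect u)"
  by (rule linearI) (auto simp: reflect_def algebra_simps inner_add_left)

lemma reflect_reflect: "norm u = 1 \<Longrightarrow> reflect u (reflect u x) = x"
  by (simp add: reflect_def inner_diff_left dot_square_norm algebra_simps)

lemma reflect_line:
  assumes "norm u = 1"
  shows "reflect u (x + t *\<^sub>R u) = x + (- (2 * (x \<bullet> u)) - t) *\<^sub>R u"
proof -
  have "t *\<^sub>R u - (2 * (x \<bullet> u) + 2 * t) *\<^sub>R u = (- (2 * (x \<bullet> u)) - t) *\<^sub>R u"
    by (simp flip: scaleR_left_diff_distrib)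
  then show ?thesis using assms by (simp add: reflect_def inner_add_left dot_square_norm distrib_left flip: add_diff_eq)
qed

lemma norm_reflect: "norm u = 1 \<Longrightarrow> norm (reflect u x) = norm x"
  unfolding norm_eq_sqrt_inner
  by (simp add: reflect_def inner_diff_left inner_diff_right inner_commute[of u x] algebra_simps)

lemma reflect_image_eq_vimage: "norm u = 1 \<Longrightarrow> reflect u ` A = reflect u -` A"
  by (force simp: reflect_reflect image_iff)

lemma continuous_on_reflect [continuous_intros]:
  "continuous_on S h \<Longrightarrow> continuous_on S (\<lambda>x. reflect u (h x))"
  unfolding reflect_def by (intro continuous_intros)

lemma borel_measurable_reflect [measurable]: "reflect u \<in> borel_measurable borel"
  by (rule borel_measurable_continuous_onI) (intro continuous_intros)

text \<open>On each line parallel to \<open>u\<close> the reflection acts as a reflection of the line.\<close>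

lemma emeasure_reflect:
  fixes A :: "'a::euclidean_space set"
  assumes u: "norm u = 1" and A [measurable]: "A \<in> sets borel"
  shows "emeasure lborel (reflect u ` A) = emeasure lborel A"
proof -
  have [measurable]: "reflect u -` A \<in> sets borel"
    using measurable_sets[OF borel_measurable_reflect A] by simp
  have line: "emeasure lborel {t. x + t *\<^sub>R u \<in> reflect u -` A} = emeasure lborel {t. x + t *\<^sub>R u \<in> A}" for x
  proof -
    have "emeasure lborel {t. x + t *\<^sub>R u \<in> A} = (\<integral>\<^sup>+t. indicator {t. x + t *\<^sub>R u \<in> A} t \<partial>lborel)"
      by (subst nn_integral_indicator) auto
    also have "\<dots> = (\<integral>\<^sup>+t. indicator {t. x + t *\<^sub>R u \<in> A} (- (2 * (x \<bullet> u)) + (-1) * t) \<partial>lborel)"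
      by (subst nn_integral_real_affine[where c="-1" and t="- (2 * (x \<bullet> u))"]) auto
    also have "\<dots> = (\<integral>\<^sup>+t. indicator {t. x + t *\<^sub>R u \<in> reflect u -` A} t \<partial>lborel)"
      by (rule nn_integral_cong) (simp add: indicator_def reflect_line[OF u])
    also have "\<dots> = emeasure lborel {t. x + t *\<^sub>R u \<in> reflect u -` A}"
      by (subst nn_integral_indicator) auto
    finally show ?thesis ..
  qed
  show ?thesis
    unfolding reflect_image_eq_vimage[OF u] emeasure_by_lines[OF \<open>reflect u -` A \<in> sets borel\<close> u]
      emeasure_by_lines[OF A u] line ..
qed

text \<open>Points \<open>x i\<close> with levels \<open>s i\<close>. The family is indexed, because points that move
  may coincide and separate again, while the levels remain attached to the indices.\<close>

locale level_family =
  fixes I :: "'i set" and s :: "'i \<Rightarrow> real" and \<alpha> :: real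
  assumes finite_I: "finite I" and nonempty_I: "I \<noteq> {}" and s_pos: "\<And>i. i \<in> I \<Longrightarrow> 0 < s i"
begin

definition pts :: "('i \<Rightarrow> 'a::euclidean_space) \<Rightarrow> ('a \<times> real) set" where
  "pts x = (\<lambda>i. (x i, s i)) ` I"

definition mass :: "('i \<Rightarrow> 'a::euclidean_space) \<Rightarrow> real" where
  "mass x = total_mass (inner_lin \<alpha> (pts x))"

lemma hypo_points_pts: "hypo_points (pts x)"
  using finite_I nonempty_I s_pos by unfold_locales (auto simp: pts_def)

lemma base_points_pts: "base_points \<alpha> (pts x) = (\<lambda>i. (x i, base_val \<alpha> (s i))) ` I"
  by (simp add: base_points_def pts_def image_image)

text \<open>For a fixed family of levels, the lifted polytopes of different positions of the points are
  linear images of one polytope. This turns a motion of the points into a motion of the whole polytope.\<close>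

lemma hull_base_points_linear_image:
  assumes "linear f" "\<And>i. i \<in> I \<Longrightarrow> f (p i) = (x i, base_val \<alpha> (s i))"
  shows "convex hull base_points \<alpha> (pts x) = f ` (convex hull (p ` I))"
  using assms by (simp add: convex_hull_linear_image base_points_pts image_image)

text \<open>Let \<open>G\<close> be the hull of the triples (initial position, final position, base value). Each of its
  points is a particle that travels parallel to \<open>u\<close>. The superlevel sets of the three inner
  linearizations are the places that the particles with small base value occupy at the start, at
  the end and half-way, so the volumes compare at every level, and the layer cake formula sums
  the comparison.\<close>

lemma mass_midpoint_le:
  fixes a b :: "'i \<Rightarrow> 'a::euclidean_space"
  assumes u: "norm u = 1" and par: "\<And>i. i \<in> I \<Longrightarrow> \<exists>c. a i - b i = c *\<^sub>R u"
  shows "2 * mass (\<lambda>i. (1/2) *\<^sub>R (a i + b i)) \<le> mass a + mass b"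
proof -
  define G where "G = convex hull ((\<lambda>i. (a i, b i, base_val \<alpha> (s i))) ` I)"
  let ?m = "\<lambda>i. (1/2) *\<^sub>R (a i + b i)"
  let ?E = "\<lambda>t. (\<lambda>(x, y, r). (x, y)) ` (G \<inter> {p. snd (snd p) \<le> base_val \<alpha> t})"
  have G: "compact G" "convex G"
    by (auto simp: G_def finite_I finite_imp_compact_convex_hull)
  have hull: "convex hull base_points \<alpha> (pts a) = (\<lambda>(x, y, r). (x, r)) ` G"
    "convex hull base_points \<alpha> (pts b) = (\<lambda>(x, y, r). (y, r)) ` G"
    "convex hull base_points \<alpha> (pts ?m) = (\<lambda>(x, y, r). ((1/2) *\<^sub>R (x + y), r)) ` G"
    unfolding G_def
    by (rule hull_base_points_linear_image; force intro!: linearI simp: algebra_simps)+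
  have lin: "linear (\<lambda>(x::'a, y::'a, r::real). (x, y))" by (auto intro!: linearI)
  have E: "compact (?E t)" "convex (?E t)" for t
  proof -
    have "closed {p :: 'a \<times> 'a \<times> real. snd (snd p) \<le> base_val \<alpha> t}"
      by (intro closed_Collect_le continuous_intros)
    then show "compact (?E t)"
      unfolding case_prod_unfold
      by (intro compact_continuous_image continuous_intros compact_Int_closed G)
    have "{p :: 'a \<times> 'a \<times> real. snd (snd p) \<le> base_val \<alpha> t} = {p. (0, 0, 1) \<bullet> p \<le> base_val \<alpha> t}"
      by (auto simp: inner_prod_def)
    then have "convex {p :: 'a \<times> 'a \<times> real. snd (snd p) \<le> base_val \<alpha> t}"
      by (simp add: convex_halfspace_le)
    then show "convex (?E t)" by (intro convex_linear_image lin convex_Int G)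
  qed
  have Epar: "\<exists>c. x - y = c *\<^sub>R u" if "(x, y) \<in> ?E t" for x y t
  proof -
    \<comment> \<open>Being parallel to \<open>u\<close> is a linear condition, so it passes from the generating points to the hull.\<close>
    have "subspace ((\<lambda>p :: 'a \<times> 'a \<times> real. fst p - fst (snd p)) -` span {u})"
      by (intro linear_subspace_vimage subspace_span linearI) (auto simp: algebra_simps)
    moreover have "a i - b i \<in> span {u}" if "i \<in> I" for i using par[OF that] by (auto simp: span_singleton)
    ultimately have "G \<subseteq> (\<lambda>p. fst p - fst (snd p)) -` span {u}"
      unfolding G_def by (intro hull_minimal subspace_imp_convex) auto
    then show ?thesis using that by (force simp: span_singleton)
  qed
  have lev: "{x. t \<le> inner_lin \<alpha> (pts a) x} = fst ` ?E t" "{x. t \<le> inner_lin \<alpha> (pts b) x} = snd ` ?E t"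
      "{x. t \<le> inner_lin \<alpha> (pts ?m) x} = (\<lambda>(x, y). (1/2) *\<^sub>R (x + y)) ` ?E t" if "0 < t" for t
    unfolding hypo_points.inner_lin_superlevel[OF hypo_points_pts that] hull
    by (force simp: image_iff)+
  have [measurable]: "inner_lin \<alpha> (pts c) \<in> borel_measurable borel" for c :: "'i \<Rightarrow> 'a"
    by (rule hypo_points.borel_measurable_inner_lin[OF hypo_points_pts])
  have [measurable]: "(\<lambda>t. emeasure lborel {x. t \<le> inner_lin \<alpha> (pts c) x}) \<in> borel_measurable borel" for c :: "'i \<Rightarrow> 'a"
  proof -
    have "{p \<in> space (lborel \<Otimes>\<^sub>M lborel). fst p \<le> inner_lin \<alpha> (pts c) (snd p)} \<in> sets (lborel \<Otimes>\<^sub>M lborel)"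
      by measurable
    from lborel.measurable_emeasure_Pair[OF this] show ?thesis
      by (simp add: vimage_def space_pair_measure)
  qed
  note cake = nn_integral_layer_cake[OF inner_lin_nonneg hypo_points.borel_measurable_inner_lin[OF hypo_points_pts]]
  have "2 * (\<integral>\<^sup>+x. inner_lin \<alpha> (pts ?m) x \<partial>lborel)
    = (\<integral>\<^sup>+t. indicator {0<..} t * (2 * emeasure lborel {x. t \<le> inner_lin \<alpha> (pts ?m) x}) \<partial>lborel)"
    unfolding cake by (subst nn_integral_cmult[symmetric]) (auto simp: mult_ac)
  also have "\<dots> \<le> (\<integral>\<^sup>+t. indicator {0<..} t * (emeasure lborel {x. t \<le> inner_lin \<alpha> (pts a) x}
      + emeasure lborel {x. t \<le> inner_lin \<alpha> (pts b) x}) \<partial>lborel)"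
  proof (intro nn_integral_mono)
    fix t :: real
    show "indicator {0<..} t * (2 * emeasure lborel {x. t \<le> inner_lin \<alpha> (pts ?m) x})
      \<le> indicator {0<..} t * (emeasure lborel {x. t \<le> inner_lin \<alpha> (pts a) x}
      + emeasure lborel {x. t \<le> inner_lin \<alpha> (pts b) x})"
      using emeasure_midpoint_parallel_le[OF E u Epar, of t] lev[of t] by (simp add: indicator_def)
  qed
  also have "\<dots> = (\<integral>\<^sup>+x. inner_lin \<alpha> (pts a) x \<partial>lborel) + (\<integral>\<^sup>+x. inner_lin \<alpha> (pts b) x \<partial>lborel)"
    unfolding cake distrib_left by (subst nn_integral_add) auto
  finally have "2 * ennreal (mass ?m) \<le> ennreal (mass a) + ennreal (mass b)"
    unfolding mass_def hypo_points.ennreal_total_mass_inner_lin[OF hypo_points_pts] .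
  moreover have nn: "0 \<le> mass c" for c :: "'i \<Rightarrow> 'a"
    unfolding mass_def total_mass_def by (intro integral_nonneg_AE) (simp add: inner_lin_nonneg)
  ultimately have "ennreal (2 * mass ?m) \<le> ennreal (mass a + mass b)"
    by (simp add: ennreal_mult)
  then show ?thesis using nn by (subst (asm) ennreal_le_iff) auto
qed

lemma mass_reflect:
  fixes a :: "'i \<Rightarrow> 'a::euclidean_space"
  assumes u: "norm u = 1"
  shows "mass (\<lambda>i. reflect u (a i)) = mass a"
  unfolding mass_def
proof (rule total_mass_cong_superlevels; (intro inner_lin_nonneg hypo_points.borel_measurable_inner_lin hypo_points_pts)?)
  fix t :: real assume t: "0 < t"
  have "convex hull base_points \<alpha> (pts (\<lambda>i. reflect u (a i)))
      = (\<lambda>p. (reflect u (fst p), snd p)) ` (convex hull base_points \<alpha> (pts a))"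
    unfolding base_points_pts[of a]
    by (rule hull_base_points_linear_image)
       (auto intro!: linearI simp: linear_add[OF linear_reflect] linear_cmul[OF linear_reflect])
  then have "{x. t \<le> inner_lin \<alpha> (pts (\<lambda>i. reflect u (a i))) x} = reflect u ` {x. t \<le> inner_lin \<alpha> (pts a) x}"
    unfolding hypo_points.inner_lin_superlevel[OF hypo_points_pts t] by (force simp: image_iff)
  then show "emeasure lborel {x. t \<le> inner_lin \<alpha> (pts (\<lambda>i. reflect u (a i))) x}
      = emeasure lborel {x. t \<le> inner_lin \<alpha> (pts a) x}"
    using emeasure_reflect[OF u compact_imp_borel[OF hypo_points.compact_inner_lin_superlevel[OF hypo_points_pts t]]]
    by simp
qed

end

text \<open>Scaling all points and all levels by \<open>c\<close> turns the function \<open>q\<close> into \<open>c * q (x / c)\<close>: one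
  factor \<open>c\<close> for the values and one for each dimension.\<close>

lemma (in level_family) mass_scale:
  fixes a :: "'i \<Rightarrow> 'a::euclidean_space"
  assumes c: "0 < c"
  shows "level_family.mass I (\<lambda>i. c * s i) \<alpha> (\<lambda>i. c *\<^sub>R a i) = c ^ (DIM('a) + 1) * mass a"
proof -
  interpret scaled: level_family I "\<lambda>i. c * s i" \<alpha>
    using finite_I nonempty_I s_pos c by unfold_locales auto
  let ?q = "inner_lin \<alpha> (pts a)" and ?r = "inner_lin \<alpha> (scaled.pts (\<lambda>i. c *\<^sub>R a i))"
  let ?T = "\<lambda>p :: 'a \<times> real. (c *\<^sub>R fst p, base_val \<alpha> c + c powr \<alpha> * snd p)"
  have hull: "convex hull base_points \<alpha> (scaled.pts (\<lambda>i. c *\<^sub>R a i)) = ?T ` (convex hull base_points \<alpha> (pts a))"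
  proof -
    let ?L = "\<lambda>p :: 'a \<times> real. (c *\<^sub>R fst p, c powr \<alpha> * snd p)"
    have L: "linear ?L" by (auto intro!: linearI simp: algebra_simps)
    have T: "?T = (+) (0, base_val \<alpha> c) \<circ> ?L" by (auto simp: fun_eq_iff)
    have "base_points \<alpha> (scaled.pts (\<lambda>i. c *\<^sub>R a i)) = ?T ` base_points \<alpha> (pts a)"
      unfolding scaled.base_points_pts base_points_pts image_image using c s_pos
      by (intro image_cong) (auto simp: base_val_mult)
    then show ?thesis
      unfolding T image_comp[symmetric] by (simp add: convex_hull_translation convex_hull_linear_image[OF L])
  qed
  have iff: "c * t \<le> ?r (c *\<^sub>R x) \<longleftrightarrow> t \<le> ?q x" if t: "0 < t" for t x
  proof -
    have cp: "0 < c powr \<alpha>" using c by simp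
    have "c * t \<le> ?r (c *\<^sub>R x) \<longleftrightarrow> (\<exists>y. base_val \<alpha> c + c powr \<alpha> * y \<le> base_val \<alpha> (c * t) \<and> (x, y) \<in> convex hull base_points \<alpha> (pts a))"
      using c t unfolding hypo_points.le_inner_lin_iff[OF scaled.hypo_points_pts mult_pos_pos[OF c t]] hull
      by force
    also have "\<dots> \<longleftrightarrow> t \<le> ?q x"
      unfolding hypo_points.le_inner_lin_iff[OF hypo_points_pts t] base_val_mult[OF c t] using cp by auto
    finally show ?thesis .
  qed
  have eq: "?r (c *\<^sub>R x) = c * ?q x" for x
  proof (rule antisym)
    show "?r (c *\<^sub>R x) \<le> c * ?q x"
    proof (cases "0 < ?r (c *\<^sub>R x)")
      case True
      then show ?thesis using iff[of "?r (c *\<^sub>R x) / c" x] c by (auto simp: field_simps)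
    next
      case False
      have "0 \<le> c * ?q x" using c by (simp add: inner_lin_nonneg)
      with False show ?thesis by linarith
    qed
    show "c * ?q x \<le> ?r (c *\<^sub>R x)"
      using iff[of "?q x" x] c inner_lin_nonneg[of \<alpha> "pts a" x] inner_lin_nonneg[of \<alpha> "scaled.pts (\<lambda>i. c *\<^sub>R a i)" "c *\<^sub>R x"]
      by (cases "0 < ?q x") auto
  qed
  note [measurable] = hypo_points.borel_measurable_inner_lin[OF hypo_points_pts]
    hypo_points.borel_measurable_inner_lin[OF scaled.hypo_points_pts]
  have "(\<integral>\<^sup>+x. ?r x \<partial>lborel) = (\<integral>\<^sup>+x. ennreal (c ^ DIM('a)) * ?r (c *\<^sub>R x) \<partial>lborel)"
    using c by (subst lborel_affine[of c 0])
      (auto simp: nn_integral_density nn_integral_distr)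
  also have "\<dots> = (\<integral>\<^sup>+x. ennreal (c ^ (DIM('a) + 1)) * ?q x \<partial>lborel)"
    using c inner_lin_nonneg[of \<alpha> "pts a"] by (intro nn_integral_cong) (auto simp: eq mult_ac simp flip: ennreal_mult)
  also have "\<dots> = ennreal (c ^ (DIM('a) + 1)) * (\<integral>\<^sup>+x. ?q x \<partial>lborel)"
    by (rule nn_integral_cmult) simp
  finally show ?thesis
    unfolding mass_def scaled.mass_def using c
    by (simp add: total_mass_eq_nn_integral inner_lin_nonneg enn2real_mult)
qed

section \<open>Steiner symmetrization\<close>

text \<open>For convex \<open>K\<close> this is the usual Steiner symmetral: if \<open>K\<close> meets a line parallel to \<open>u\<close> in a
  segment, then the points \<open>(a + reflect u b) / 2\<close> with \<open>a\<close> and \<open>b\<close> in this segment fill the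
  segment of the same length that is centred on the mirror. In this form, convexity and
  compactness are inherited at once, and every point of the symmetral comes with the pair of points
  of \<open>K\<close> that is needed for the comparison of masses.\<close>

definition steiner :: "'a::euclidean_space \<Rightarrow> 'a set \<Rightarrow> 'a set" where
  "steiner u K = {(1/2) *\<^sub>R (a + reflect u b) | a b. a \<in> K \<and> b \<in> K \<and> (\<exists>c. a - b = c *\<^sub>R u)}"

text \<open>By convexity, the mass of the midpoints is at most the mean of the masses of the points \<open>a i\<close> and of
  the reflected points \<open>b i\<close>. Reflections preserve mass, so one of the two families \<open>a\<close> and
  \<open>b\<close> does at least as well.\<close>

lemma (in level_family) mass_le_steiner:
  assumes u: "norm u = 1" and z: "\<And>i. i \<in> I \<Longrightarrow> z i \<in> steiner u (K i)"
  obtains x where "\<And>i. i \<in> I \<Longrightarrow> x i \<in> K i" "mass z \<le> mass x"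
proof -
  have "\<exists>a b. a \<in> K i \<and> b \<in> K i \<and> (\<exists>c. a - b = c *\<^sub>R u) \<and> z i = (1/2) *\<^sub>R (a + reflect u b)" if "i \<in> I" for i
    using z[OF that] unfolding steiner_def by blast
  then obtain a b where K: "\<And>i. i \<in> I \<Longrightarrow> a i \<in> K i" "\<And>i. i \<in> I \<Longrightarrow> b i \<in> K i"
    and par: "\<And>i. i \<in> I \<Longrightarrow> \<exists>c. a i - b i = c *\<^sub>R u"
    and zi: "\<And>i. i \<in> I \<Longrightarrow> z i = (1/2) *\<^sub>R (a i + reflect u (b i))"
    by metis
  have "pts z = pts (\<lambda>i. (1/2) *\<^sub>R (a i + reflect u (b i)))"
    unfolding pts_def using zi by (intro image_cong) auto
  then have "2 * mass z = 2 * mass (\<lambda>i. (1/2) *\<^sub>R (a i + reflect u (b i)))" by (simp add: mass_def)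
  also have "\<dots> \<le> mass a + mass (\<lambda>i. reflect u (b i))"
  proof (rule mass_midpoint_le[OF u])
    fix i assume "i \<in> I"
    then obtain c where c: "a i - b i = c *\<^sub>R u" using par by blast
    have "a i - reflect u (b i) = (a i - b i) + (2 * (b i \<bullet> u)) *\<^sub>R u" by (simp add: reflect_def)
    then have "a i - reflect u (b i) = (c + 2 * (b i \<bullet> u)) *\<^sub>R u" unfolding c by (simp add: scaleR_left_distrib)
    then show "\<exists>c. a i - reflect u (b i) = c *\<^sub>R u" ..
  qed
  also have "\<dots> = mass a + mass b" by (simp add: mass_reflect u)
  finally have "mass z \<le> mass a \<or> mass z \<le> mass b" by linarith
  with that[of a] that[of b] K show ?thesis by blast
qed

lemma steinerI: "a \<in> K \<Longrightarrow> b \<in> K \<Longrightarrow> a - b = c *\<^sub>R u \<Longrightarrow> z = (1/2) *\<^sub>R (a + reflect u b) \<Longrightarrow> z \<in> steiner u K"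
  unfolding steiner_def by blast

lemma steinerE:
  assumes "z \<in> steiner u K"
  obtains a b c where "a \<in> K" "b \<in> K" "a - b = c *\<^sub>R u" "z = (1/2) *\<^sub>R (a + reflect u b)"
  using assms unfolding steiner_def by blast

lemma steiner_mono: "K \<subseteq> L \<Longrightarrow> steiner u K \<subseteq> steiner u L"
  unfolding steiner_def by blast

lemma steiner_subset_cball:
  assumes "K \<subseteq> cball 0 \<rho>" "norm u = 1"
  shows "steiner u K \<subseteq> cball 0 \<rho>"
proof
  fix z assume "z \<in> steiner u K"
  then obtain a b where ab: "a \<in> K" "b \<in> K" "z = (1/2) *\<^sub>R (a + reflect u b)" by (auto elim: steinerE)
  then have "norm a \<le> \<rho>" "norm (reflect u b) \<le> \<rho>" using assms by (auto simp: norm_reflect subset_iff)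
  then show "z \<in> cball 0 \<rho>" using norm_triangle_ineq[of a "reflect u b"] ab by simp
qed

lemma steiner_scaleR: "steiner u ((*\<^sub>R) c ` K) \<subseteq> (*\<^sub>R) c ` steiner u K"
proof (cases "c = 0")
  case True
  show ?thesis
  proof
    fix z assume "z \<in> steiner u ((*\<^sub>R) c ` K)"
    then obtain a where "a \<in> K" "z = 0" using True by (auto elim!: steinerE simp: reflect_def)
    moreover from \<open>a \<in> K\<close> have "(1/2) *\<^sub>R (a + reflect u a) \<in> steiner u K" by (auto intro: steinerI[where c=0])
    ultimately show "z \<in> (*\<^sub>R) c ` steiner u K" using True by force
  qed
next
  case False
  show ?thesis
  proof
    fix z assume "z \<in> steiner u ((*\<^sub>R) c ` K)"
    then obtain a b d where ab: "a \<in> K" "b \<in> K" "c *\<^sub>R a - c *\<^sub>R b = d *\<^sub>R u"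
        "z = (1/2) *\<^sub>R (c *\<^sub>R a + reflect u (c *\<^sub>R b))" by (auto elim!: steinerE)
    have "a - b = (1/c) *\<^sub>R (c *\<^sub>R a - c *\<^sub>R b)" using False by (simp add: algebra_simps)
    then have "a - b = (d / c) *\<^sub>R u" using ab by simp
    then have "(1/2) *\<^sub>R (a + reflect u b) \<in> steiner u K" using ab by (auto intro: steinerI)
    moreover have "z = c *\<^sub>R ((1/2) *\<^sub>R (a + reflect u b))"
      using ab(4) by (simp add: linear_cmul[OF linear_reflect] algebra_simps)
    ultimately show "z \<in> (*\<^sub>R) c ` steiner u K" by blast
  qed
qed

lemma convex_steiner:
  assumes "convex K"
  shows "convex (steiner u K)"
proof (rule convexI)
  fix x y k l assume "x \<in> steiner u K" "y \<in> steiner u K" and kl: "0 \<le> k" "0 \<le> l" "k + l = (1::real)"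
  then obtain a b c a' b' c' where *: "a \<in> K" "b \<in> K" "a - b = c *\<^sub>R u" "x = (1/2) *\<^sub>R (a + reflect u b)"
    "a' \<in> K" "b' \<in> K" "a' - b' = c' *\<^sub>R u" "y = (1/2) *\<^sub>R (a' + reflect u b')" by (metis steinerE)
  show "k *\<^sub>R x + l *\<^sub>R y \<in> steiner u K"
  proof (rule steinerI)
    show "k *\<^sub>R a + l *\<^sub>R a' \<in> K" "k *\<^sub>R b + l *\<^sub>R b' \<in> K" using assms * kl by (auto intro: convexD)
    have "(k *\<^sub>R a + l *\<^sub>R a') - (k *\<^sub>R b + l *\<^sub>R b') = k *\<^sub>R (a - b) + l *\<^sub>R (a' - b')" by (simp add: algebra_simps)
    then show "(k *\<^sub>R a + l *\<^sub>R a') - (k *\<^sub>R b + l *\<^sub>R b') = (k * c + l * c') *\<^sub>R u" using * by (simp add: algebra_simps)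
    show "k *\<^sub>R x + l *\<^sub>R y = (1/2) *\<^sub>R (k *\<^sub>R a + l *\<^sub>R a' + reflect u (k *\<^sub>R b + l *\<^sub>R b'))"
      using * by (simp add: linear_add[OF linear_reflect] linear_cmul[OF linear_reflect] algebra_simps)
  qed
qed

lemma compact_steiner:
  assumes "compact K"
  shows "compact (steiner u K)"
proof -
  have "closed ((\<lambda>p :: 'a \<times> 'a. fst p - snd p) -` span {u})"
    by (intro continuous_closed_vimage closed_span) (auto intro!: continuous_intros)
  then have "compact ((K \<times> K) \<inter> (\<lambda>p. fst p - snd p) -` span {u})"
    by (intro compact_Int_closed compact_Times assms)
  then have "compact ((\<lambda>p. (1/2) *\<^sub>R (fst p + reflect u (snd p))) ` ((K \<times> K) \<inter> (\<lambda>p. fst p - snd p) -` span {u}))"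
    by (intro compact_continuous_image) (auto intro!: continuous_intros)
  also have "(\<lambda>p. (1/2) *\<^sub>R (fst p + reflect u (snd p))) ` ((K \<times> K) \<inter> (\<lambda>p. fst p - snd p) -` span {u}) = steiner u K"
  proof (intro equalityI subsetI)
    fix z assume "z \<in> steiner u K"
    then obtain a b c where "a \<in> K" "b \<in> K" "a - b = c *\<^sub>R u" "z = (1/2) *\<^sub>R (a + reflect u b)"
      by (rule steinerE)
    then show "z \<in> (\<lambda>p. (1/2) *\<^sub>R (fst p + reflect u (snd p))) ` ((K \<times> K) \<inter> (\<lambda>p. fst p - snd p) -` span {u})"
      by (intro image_eqI[of _ _ "(a, b)"]) (auto simp: span_singleton)
  qed (auto simp: span_singleton intro: steinerI)
  finally show ?thesis .
qed

text \<open>On every line parallel to \<open>u\<close> the symmetral contains a segment as long as the one that \<open>K\<close> cuts out.\<close>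

lemma emeasure_le_steiner:
  fixes K :: "'a::euclidean_space set"
  assumes K: "compact K" "convex K" and u: "norm u = 1"
  shows "emeasure lborel K \<le> emeasure lborel (steiner u K)"
proof -
  have line: "emeasure lborel {t. x + t *\<^sub>R u \<in> K} \<le> emeasure lborel {t. x + t *\<^sub>R u \<in> steiner u K}" for x
  proof (cases "{t. x + t *\<^sub>R u \<in> K} = {}")
    case False
    have "convex {t. x + t *\<^sub>R u \<in> K}"
    proof (rule convexI)
      fix s t k l :: real assume *: "s \<in> {t. x + t *\<^sub>R u \<in> K}" "t \<in> {t. x + t *\<^sub>R u \<in> K}" "0 \<le> k" "0 \<le> l" "k + l = 1"
      have "x + (k *\<^sub>R s + l *\<^sub>R t) *\<^sub>R u = (k + l) *\<^sub>R x + (k *\<^sub>R s + l *\<^sub>R t) *\<^sub>R u" using * by simp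
      also have "\<dots> = k *\<^sub>R (x + s *\<^sub>R u) + l *\<^sub>R (x + t *\<^sub>R u)" by (simp add: algebra_simps)
      also have "\<dots> \<in> K" using * K(2) by (auto intro: convexD)
      finally show "k *\<^sub>R s + l *\<^sub>R t \<in> {t. x + t *\<^sub>R u \<in> K}" by simp
    qed
    then obtain c d where cd: "c \<le> d" "{t. x + t *\<^sub>R u \<in> K} = {c..d}"
      using compact_convex_real compact_line_slice[OF K(1) u] False by metis
    \<comment> \<open>The centred segment of the same length: its point at height \<open>w\<close> above the mirror arises from the points of \<open>K\<close> at distance \<open>w\<close> on either side of the midpoint.\<close>
    have "{-(d - c)/2 - x \<bullet> u .. (d - c)/2 - x \<bullet> u} \<subseteq> {t. x + t *\<^sub>R u \<in> steiner u K}"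
    proof clarify
      fix t assume t: "t \<in> {-(d - c)/2 - x \<bullet> u .. (d - c)/2 - x \<bullet> u}"
      define w where "w = t + x \<bullet> u"
      have "(c + d)/2 + w \<in> {c..d}" "(c + d)/2 - w \<in> {c..d}" using t by (auto simp: w_def field_simps)
      then have in_K: "x + ((c + d)/2 + w) *\<^sub>R u \<in> K" "x + ((c + d)/2 - w) *\<^sub>R u \<in> K" using cd by blast+
      show "x + t *\<^sub>R u \<in> steiner u K"
      proof (rule steinerI[OF in_K])
        show "x + ((c + d)/2 + w) *\<^sub>R u - (x + ((c + d)/2 - w) *\<^sub>R u) = (2 * w) *\<^sub>R u"
          by (simp flip: scaleR_left_diff_distrib)
        have "x + ((c + d)/2 + w) *\<^sub>R u + reflect u (x + ((c + d)/2 - w) *\<^sub>R u)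
            = 2 *\<^sub>R x + (((c + d)/2 + w) + (- (2 * (x \<bullet> u)) - ((c + d)/2 - w))) *\<^sub>R u"
          unfolding reflect_line[OF u] scaleR_left_distrib[of _ _ u] scaleR_2 by (simp only: add_ac)
        also have "((c + d)/2 + w) + (- (2 * (x \<bullet> u)) - ((c + d)/2 - w)) = 2 * t"
          by (simp add: w_def)
        also have "2 *\<^sub>R x + (2 * t) *\<^sub>R u = 2 *\<^sub>R (x + t *\<^sub>R u)"
          by (simp only: scaleR_right_distrib scaleR_scaleR)
        finally show "x + t *\<^sub>R u = (1/2) *\<^sub>R (x + ((c + d)/2 + w) *\<^sub>R u + reflect u (x + ((c + d)/2 - w) *\<^sub>R u))"
          by simp
      qed
    qed
    then have "emeasure lborel {-(d - c)/2 - x \<bullet> u .. (d - c)/2 - x \<bullet> u} \<le> emeasure lborel {t. x + t *\<^sub>R u \<in> steiner u K}"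
      by (intro emeasure_mono) (auto intro!: compact_imp_borel compact_line_slice compact_steiner K u)
    moreover have "emeasure lborel {-(d - c)/2 - x \<bullet> u .. (d - c)/2 - x \<bullet> u} = ennreal (d - c)"
      using cd(1) by (subst emeasure_lborel_Icc) (auto simp: field_simps intro!: arg_cong[where f=ennreal])
    ultimately show ?thesis unfolding cd(2) using cd(1) by simp
  qed simp
  show ?thesis
    unfolding emeasure_by_lines[OF compact_imp_borel[OF K(1)] u]
      emeasure_by_lines[OF compact_imp_borel[OF compact_steiner[OF K(1)]] u]
    by (intro nn_integral_mono mult_left_mono line) simp
qed

text \<open>By strict convexity of the ball, a midpoint on the bounding sphere is the midpoint of two equal
  points. So the part of the sphere that is reached by the symmetral shrinks to the intersection of \<open>K\<close>
  with its mirror image.\<close>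

lemma steiner_sphere:
  assumes K: "K \<subseteq> cball 0 \<rho>" and u: "norm u = 1" and z: "z \<in> steiner u K" "norm z = \<rho>"
  shows "z \<in> K" "reflect u z \<in> K"
proof -
  obtain a b where ab: "a \<in> K" "b \<in> K" "z = (1/2) *\<^sub>R (a + reflect u b)" using z by (auto elim: steinerE)
  let ?b = "reflect u b"
  have le: "norm a \<le> \<rho>" "norm ?b \<le> \<rho>" using ab K u by (auto simp: norm_reflect subset_iff)
  have "norm (a + ?b) = 2 * \<rho>" using z ab by simp
  then have "(a + ?b) \<bullet> (a + ?b) = 4 * \<rho>\<^sup>2" by (simp add: dot_square_norm power_mult_distrib)
  moreover have "(a - ?b) \<bullet> (a - ?b) = 2 * (a \<bullet> a) + 2 * (?b \<bullet> ?b) - (a + ?b) \<bullet> (a + ?b)"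
    by (simp add: inner_add inner_diff inner_commute)
  moreover have "a \<bullet> a \<le> \<rho>\<^sup>2" "?b \<bullet> ?b \<le> \<rho>\<^sup>2" using le by (auto simp: dot_square_norm power_mono)
  ultimately have "(a - ?b) \<bullet> (a - ?b) \<le> 0" by linarith
  then have "(a - ?b) \<bullet> (a - ?b) = 0" using inner_ge_zero by (rule order_antisym)
  then have "a = ?b" by simp
  then have "z = a" using ab by (simp flip: scaleR_2)
  then show "z \<in> K" "reflect u z \<in> K" using ab \<open>a = ?b\<close> u by (auto simp: reflect_reflect)
qed

abbreviation steiners :: "'a::euclidean_space list \<Rightarrow> 'a set \<Rightarrow> 'a set" where
  "steiners \<equiv> fold steiner"

lemma steiners_mono: "K \<subseteq> L \<Longrightarrow> steiners us K \<subseteq> steiners us L"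
  by (induction us arbitrary: K L) (simp_all add: steiner_mono)

lemma steiners_subset_cball:
  "K \<subseteq> cball 0 \<rho> \<Longrightarrow> \<forall>u\<in>set us. norm u = 1 \<Longrightarrow> steiners us K \<subseteq> cball 0 \<rho>"
  by (induction us arbitrary: K) (auto simp: steiner_subset_cball)

lemma steiners_scaleR: "steiners us ((*\<^sub>R) c ` K) \<subseteq> (*\<^sub>R) c ` steiners us K"
proof (induction us arbitrary: K)
  case (Cons u us)
  have "steiners (u # us) ((*\<^sub>R) c ` K) \<subseteq> steiners us ((*\<^sub>R) c ` steiner u K)"
    by (simp add: steiners_mono steiner_scaleR)
  also have "\<dots> \<subseteq> (*\<^sub>R) c ` steiners us (steiner u K)" by (rule Cons)
  finally show ?case by simp
qed simp

lemma compact_steiners: "compact K \<Longrightarrow> compact (steiners us K)"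
  by (induction us arbitrary: K) (auto simp: compact_steiner)

lemma convex_steiners: "convex K \<Longrightarrow> convex (steiners us K)"
  by (induction us arbitrary: K) (auto simp: convex_steiner)

lemma emeasure_le_steiners:
  "compact K \<Longrightarrow> convex K \<Longrightarrow> \<forall>u\<in>set us. norm u = 1 \<Longrightarrow> emeasure lborel K \<le> emeasure lborel (steiners us K)"
proof (induction us arbitrary: K)
  case (Cons u us)
  then have "emeasure lborel K \<le> emeasure lborel (steiner u K)" by (simp add: emeasure_le_steiner)
  also have "\<dots> \<le> emeasure lborel (steiners us (steiner u K))"
    using Cons by (simp add: compact_steiner convex_steiner)
  finally show ?case by simp
qed simp

section \<open>Simultaneous rounding of convex bodies\<close>

text \<open>The mirror is the perpendicular bisector of the two vectors.\<close>

lemma reflect_swap: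
  fixes v w :: "'a::euclidean_space"
  assumes "norm v = norm w" "v \<noteq> w"
  obtains u where "norm u = 1" "reflect u v = w"
proof
  let ?n = "norm (v - w)"
  have n: "?n > 0" using assms by simp
  show "norm ((1 / ?n) *\<^sub>R (v - w)) = 1" using n by simp
  have "v \<bullet> v = w \<bullet> w" using assms(1) by (simp add: norm_eq)
  then have "?n\<^sup>2 = 2 * (v \<bullet> (v - w))"
    by (simp add: power2_norm_eq_inner inner_diff_left inner_diff_right inner_commute[of w v])
  then have vw: "v \<bullet> (v - w) = ?n * ?n / 2" by (simp add: power2_eq_square)
  have "2 * (v \<bullet> (v - w)) / ?n / ?n = 1" unfolding vw using n by simp
  then show "reflect ((1 / ?n) *\<^sub>R (v - w)) v = w"
    by (simp add: reflect_def divide_inverse mult_ac)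
qed

lemma inner_reflect: "reflect u x \<bullet> y = x \<bullet> reflect u y"
  by (simp add: reflect_def inner_diff inner_commute)

text \<open>The symmetrizations along \<open>us\<close> carry a missing cap around \<open>\<theta>\<close> to caps around all points of \<open>V\<close>:
  whatever set in the unit ball avoids the cap at height \<open>h\<close> around \<open>\<theta>\<close>, its symmetral avoids the
  unit sphere within the cap around each \<open>v\<close> in \<open>V\<close>. The clause \<open>z \<in> K\<close> makes the property
  inductive: no new points of the sphere appear, so caps that are missing stay missing.\<close>

definition spreads_cap :: "'a::euclidean_space list \<Rightarrow> real \<Rightarrow> 'a \<Rightarrow> 'a set \<Rightarrow> bool" where
  "spreads_cap us h \<theta> V \<longleftrightarrow> (\<forall>K z. K \<subseteq> cball 0 1 \<longrightarrow> (\<forall>x\<in>K. x \<bullet> \<theta> \<le> h) \<longrightarrow>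
      z \<in> steiners us K \<longrightarrow> norm z = 1 \<longrightarrow> z \<in> K \<and> (\<forall>v\<in>V. z \<bullet> v \<le> h))"

lemma spreads_capD:
  assumes "spreads_cap us h \<theta> V" "K \<subseteq> cball 0 1" "\<forall>x\<in>K. x \<bullet> \<theta> \<le> h" "z \<in> steiners us K" "norm z = 1"
  shows "z \<in> K" "\<forall>v\<in>V. z \<bullet> v \<le> h"
proof -
  have "z \<in> K \<and> (\<forall>v\<in>V. z \<bullet> v \<le> h)"
    by (rule assms(1)[unfolded spreads_cap_def, THEN spec, THEN spec, THEN mp, THEN mp, THEN mp, THEN mp, OF assms(2-)])
  then show "z \<in> K" "\<forall>v\<in>V. z \<bullet> v \<le> h" by simp_all
qed

text \<open>One reflection for each point of \<open>V\<close>, exchanging \<open>\<theta>\<close> with that point.\<close>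

lemma ex_spreads_cap:
  fixes \<theta> :: "'a::euclidean_space"
  assumes \<theta>: "norm \<theta> = 1" and "finite V" "V \<subseteq> sphere 0 1"
  shows "\<exists>us. (\<forall>u\<in>set us. norm u = 1) \<and> spreads_cap us h \<theta> V"
  using assms(2,3)
proof (induction V rule: finite_induct)
  case empty
  show ?case by (intro exI[of _ "[]"]) (simp add: spreads_cap_def)
next
  case (insert v V)
  then obtain us where us: "\<forall>u\<in>set us. norm u = 1" "spreads_cap us h \<theta> V" by auto
  show ?case
  proof (cases "\<theta> = v")
    case True
    have "spreads_cap us h \<theta> (insert v V)"
      unfolding spreads_cap_def
    proof (intro allI impI conjI)
      fix K z assume K: "K \<subseteq> cball 0 1" "\<forall>x\<in>K. x \<bullet> \<theta> \<le> h" and z: "z \<in> steiners us K" "norm z = 1"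
      show "z \<in> K" "\<forall>w\<in>insert v V. z \<bullet> w \<le> h" using spreads_capD[OF us(2) K z] K(2) True by simp_all
    qed
    with us(1) show ?thesis by blast
  next
    case False
    moreover have "norm \<theta> = norm v" using \<theta> insert.prems by simp
    ultimately obtain u where u: "norm u = 1" "reflect u \<theta> = v" by (metis reflect_swap)
    have "spreads_cap (us @ [u]) h \<theta> (insert v V)"
      unfolding spreads_cap_def
    proof (intro allI impI conjI)
      fix K z assume K: "K \<subseteq> cball 0 1" "\<forall>x\<in>K. x \<bullet> \<theta> \<le> h" and z: "z \<in> steiners (us @ [u]) K" "norm z = 1"
      have z': "z \<in> steiners us K" "reflect u z \<in> steiners us K"
        using steiner_sphere[OF steiners_subset_cball[OF K(1) us(1)] u(1), of z] z by simp_all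
      show "z \<in> K" using spreads_capD(1)[OF us(2) K z'(1) z(2)] .
      have "reflect u z \<in> K" using spreads_capD(1)[OF us(2) K z'(2)] z(2) u(1) by (simp add: norm_reflect)
      then have "reflect u z \<bullet> \<theta> \<le> h" using K(2) by simp
      then have "z \<bullet> v \<le> h" by (simp add: inner_reflect u(2))
      then show "\<forall>w\<in>insert v V. z \<bullet> w \<le> h" using spreads_capD(2)[OF us(2) K z'(1) z(2)] by simp
    qed
    moreover have "\<forall>w\<in>set (us @ [u]). norm w = 1" using us(1) u by simp
    ultimately show ?thesis by blast
  qed
qed

text \<open>Finitely many caps cover the sphere. Once all of them are missing, the symmetral no longer meets the
  sphere and, being compact, lies in a smaller ball.\<close>

lemma steiners_shrink_capped_ball:
  fixes \<theta> :: "'a::euclidean_space"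
  assumes \<theta>: "norm \<theta> = 1" and h: "h < 1"
  shows "\<exists>us \<delta>. (\<forall>u\<in>set us. norm u = 1) \<and> 0 < \<delta> \<and> \<delta> < 1 \<and> steiners us (cball 0 1 \<inter> {x. x \<bullet> \<theta> \<le> h}) \<subseteq> cball 0 (1 - \<delta>)"
proof -
  obtain V where V: "V \<subseteq> sphere (0::'a) 1" "finite V" "sphere 0 1 \<subseteq> (\<Union>v\<in>V. {x. h < x \<bullet> v})"
  proof (rule compactE_image[of "sphere (0::'a) 1" "sphere 0 1" "\<lambda>v. {x. h < x \<bullet> v}"])
    show "open {x. h < x \<bullet> v}" for v :: 'a by (intro open_Collect_less continuous_intros)
    show "sphere 0 1 \<subseteq> (\<Union>v\<in>sphere (0::'a) 1. {x. h < x \<bullet> v})"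
      using h by (auto simp: dot_square_norm intro!: bexI)
  qed auto
  let ?K = "cball (0::'a) 1 \<inter> {x. x \<bullet> \<theta> \<le> h}"
  obtain us where us1: "\<forall>u\<in>set us. norm u = 1" and spreads: "spreads_cap us h \<theta> V"
    using ex_spreads_cap[OF \<theta> V(2,1)] by blast
  have us2: "\<forall>v\<in>V. z \<bullet> v \<le> h" if "z \<in> steiners us ?K" "norm z = 1" for z
    by (rule spreads_capD(2)[OF spreads _ _ that]) auto
  have "closed {x. x \<bullet> \<theta> \<le> h}" by (intro closed_Collect_le continuous_intros)
  then have cpt: "compact (steiners us ?K)" by (intro compact_steiners compact_Int_closed compact_cball)
  have lt: "norm z < 1" if "z \<in> steiners us ?K" for z
  proof -
    have "norm z \<le> 1" using steiners_subset_cball[of ?K 1 us] us1 that by auto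
    moreover have "norm z \<noteq> 1"
    proof
      assume "norm z = 1"
      then have "z \<in> (\<Union>v\<in>V. {x. h < x \<bullet> v})" using V(3) by auto
      then show False using us2[OF that \<open>norm z = 1\<close>] by force
    qed
    ultimately show ?thesis by simp
  qed
  show ?thesis
  proof (cases "steiners us ?K = {}")
    case True
    then show ?thesis using us1 by (intro exI[of _ us] exI[of _ "1/2"]) auto
  next
    case False
    then obtain z where z: "z \<in> steiners us ?K" "\<And>y. y \<in> steiners us ?K \<Longrightarrow> norm y \<le> norm z"
      using continuous_attains_sup[OF cpt False, of norm] continuous_on_norm_id by blast
    \<comment> \<open>Half of the gap, so that the shrinking factor is positive even if the symmetral is the origin alone.\<close>
    define d where "d = (1 - norm z) / 2"
    have d: "norm z = 1 - 2 * d" by (simp add: d_def field_simps)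
    have "norm y \<le> 1 - d" if "y \<in> steiners us ?K" for y
    proof -
      have "norm y \<le> norm z" using z(2)[OF that] .
      also have "\<dots> \<le> 1 - d" using lt[OF z(1)] unfolding d by simp
      finally show ?thesis .
    qed
    then have "steiners us ?K \<subseteq> cball 0 (1 - d)" by (simp add: subset_iff)
    moreover have "0 < d" using lt[OF z(1)] by (simp add: d_def)
    moreover have "d < 1" using norm_ge_zero[of z] unfolding d by simp
    ultimately show ?thesis using us1 by blast
  qed
qed

text \<open>The shrinking factor can be chosen for all directions at once: finitely many directions come close
  to every direction, and the ball without the cap of size \<open>\<epsilon>\<close> around \<open>\<theta>\<close> lies in the ball without the
  cap of size \<open>\<epsilon> / 2\<close> around a nearby direction.\<close>

lemma steiners_shrink_uniform:
  assumes "0 < \<epsilon>"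
  shows "\<exists>\<delta>>0. \<delta> < 1 \<and> (\<forall>\<theta>::'a::euclidean_space. norm \<theta> = 1 \<longrightarrow>
     (\<exists>us. (\<forall>u\<in>set us. norm u = 1) \<and> steiners us (cball 0 1 \<inter> {x. x \<bullet> \<theta> \<le> 1 - \<epsilon>}) \<subseteq> cball 0 (1 - \<delta>)))"
proof -
  let ?K = "\<lambda>h (\<theta>::'a). cball 0 1 \<inter> {x. x \<bullet> \<theta> \<le> h}"
  have "\<forall>\<theta>::'a. \<exists>us \<delta>. norm \<theta> = 1 \<longrightarrow> (\<forall>u\<in>set us. norm u = 1) \<and> 0 < \<delta> \<and> \<delta> < 1 \<and> steiners us (?K (1 - \<epsilon>/2) \<theta>) \<subseteq> cball 0 (1 - \<delta>)"
    using steiners_shrink_capped_ball[of _ "1 - \<epsilon>/2"] assms by auto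
  then obtain us d where us: "\<And>\<theta>::'a. norm \<theta> = 1 \<Longrightarrow> (\<forall>u\<in>set (us \<theta>). norm u = 1) \<and> 0 < d \<theta> \<and> d \<theta> < 1 \<and> steiners (us \<theta>) (?K (1 - \<epsilon>/2) \<theta>) \<subseteq> cball 0 (1 - d \<theta>)"
    by metis
  obtain D where D: "D \<subseteq> sphere (0::'a) 1" "finite D" "sphere 0 1 \<subseteq> (\<Union>v\<in>D. ball v (\<epsilon>/2))"
    by (rule compactE_image[of "sphere (0::'a) 1" "sphere 0 1" "\<lambda>v. ball v (\<epsilon>/2)"]) (use assms in auto)
  have "D \<noteq> {}" 
  proof -
    obtain b :: 'a where "b \<in> Basis" using nonempty_Basis by blast
    then have "b \<in> sphere 0 1" by simp
    with D(3) show ?thesis by blast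
  qed
  define \<delta> where "\<delta> = Min (d ` D)"
  have D1: "norm v = 1" if "v \<in> D" for v using D(1) that by auto
  have "\<delta> \<in> d ` D" unfolding \<delta>_def using D(2) \<open>D \<noteq> {}\<close> by (intro Min_in) auto
  then have "0 < \<delta>" "\<delta> < 1" using us D1 by auto
  moreover have "\<exists>us. (\<forall>u\<in>set us. norm u = 1) \<and> steiners us (?K (1 - \<epsilon>) \<theta>) \<subseteq> cball 0 (1 - \<delta>)"
    if "norm \<theta> = 1" for \<theta> :: 'a
  proof -
    have "\<theta> \<in> sphere 0 1" using that by simp
    with D(3) obtain v where v: "v \<in> D" "dist v \<theta> < \<epsilon>/2" by auto
    have "?K (1 - \<epsilon>) \<theta> \<subseteq> ?K (1 - \<epsilon>/2) v"
    proof clarsimp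
      fix x :: 'a assume x: "norm x \<le> 1" "x \<bullet> \<theta> \<le> 1 - \<epsilon>"
      have "x \<bullet> (v - \<theta>) \<le> norm x * norm (v - \<theta>)" by (rule norm_cauchy_schwarz)
      also have "\<dots> \<le> 1 * norm (v - \<theta>)" using x by (intro mult_right_mono) auto
      finally show "x \<bullet> v \<le> 1 - \<epsilon>/2" using x v by (simp add: inner_diff_right dist_norm)
    qed
    then have "steiners (us v) (?K (1 - \<epsilon>) \<theta>) \<subseteq> steiners (us v) (?K (1 - \<epsilon>/2) v)" by (rule steiners_mono)
    also have "\<dots> \<subseteq> cball 0 (1 - d v)" using us D1[OF v(1)] by blast
    also have "\<dots> \<subseteq> cball 0 (1 - \<delta>)"
      using v(1) D(2) by (intro subset_cball) (simp add: \<delta>_def Min_le)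
    finally show ?thesis using us D1[OF v(1)] by blast
  qed
  ultimately show ?thesis by blast
qed

text \<open>A convex body that does not contain the ball of radius \<open>(1 - \<epsilon>) * \<rho>\<close> is separated from a point of
  that ball, hence it misses the cap that the separating hyperplane cuts off the circumscribed ball.\<close>

lemma steiners_shrink:
  fixes K :: "'a::euclidean_space set"
  assumes \<delta>: "\<forall>\<theta>::'a. norm \<theta> = 1 \<longrightarrow>
     (\<exists>us. (\<forall>u\<in>set us. norm u = 1) \<and> steiners us (cball 0 1 \<inter> {x. x \<bullet> \<theta> \<le> 1 - \<epsilon>}) \<subseteq> cball 0 (1 - \<delta>))"
    and K: "compact K" "convex K" "K \<noteq> {}" "K \<subseteq> cball 0 \<rho>" and \<rho>: "0 < \<rho>"
    and not: "\<not> cball 0 ((1 - \<epsilon>) * \<rho>) \<subseteq> K"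
  shows "\<exists>us. (\<forall>u\<in>set us. norm u = 1) \<and> steiners us K \<subseteq> cball 0 ((1 - \<delta>) * \<rho>)"
proof -
  obtain z where z: "norm z \<le> (1 - \<epsilon>) * \<rho>" "z \<notin> K" using not by (metis mem_cball_0 subsetI)
  then obtain a b where ab: "a \<bullet> z < b" "\<And>x. x \<in> K \<Longrightarrow> b < a \<bullet> x"
    using separating_hyperplane_closed_point[OF K(2) compact_imp_closed[OF K(1)], of z] by blast
  have "a \<noteq> 0" using ab K(3) by force
  define \<theta> where "\<theta> = (- 1 / norm a) *\<^sub>R a"
  have \<theta>: "norm \<theta> = 1" using \<open>a \<noteq> 0\<close> by (simp add: \<theta>_def)
  have x\<theta>: "x \<bullet> \<theta> \<le> (1 - \<epsilon>) * \<rho>" if "x \<in> K" for x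
  proof -
    have "a \<bullet> z < a \<bullet> x" using ab that by force
    then have "x \<bullet> \<theta> \<le> z \<bullet> \<theta>" using \<open>a \<noteq> 0\<close> by (simp add: \<theta>_def inner_commute divide_right_mono)
    also have "\<dots> \<le> norm z * norm \<theta>" by (rule norm_cauchy_schwarz)
    finally show ?thesis using z \<theta> by simp
  qed
  obtain us where us: "\<forall>u\<in>set us. norm u = 1" "steiners us (cball 0 1 \<inter> {x. x \<bullet> \<theta> \<le> 1 - \<epsilon>}) \<subseteq> cball 0 (1 - \<delta>)"
    using \<delta> \<theta> by blast
  have "K \<subseteq> (*\<^sub>R) \<rho> ` (cball 0 1 \<inter> {x. x \<bullet> \<theta> \<le> 1 - \<epsilon>})"
  proof
    fix x assume "x \<in> K"
    then have "(1/\<rho>) *\<^sub>R x \<in> cball 0 1 \<inter> {x. x \<bullet> \<theta> \<le> 1 - \<epsilon>}"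
      using K(4) x\<theta>[of x] \<rho> by (auto simp: field_simps subset_iff)
    then show "x \<in> (*\<^sub>R) \<rho> ` (cball 0 1 \<inter> {x. x \<bullet> \<theta> \<le> 1 - \<epsilon>})"
      using \<rho> by (intro image_eqI[of _ _ "(1/\<rho>) *\<^sub>R x"]) auto
  qed
  then have "steiners us K \<subseteq> steiners us ((*\<^sub>R) \<rho> ` (cball 0 1 \<inter> {x. x \<bullet> \<theta> \<le> 1 - \<epsilon>}))" by (rule steiners_mono)
  also have "\<dots> \<subseteq> (*\<^sub>R) \<rho> ` steiners us (cball 0 1 \<inter> {x. x \<bullet> \<theta> \<le> 1 - \<epsilon>})" by (rule steiners_scaleR)
  also have "\<dots> \<subseteq> (*\<^sub>R) \<rho> ` cball 0 (1 - \<delta>)" using us(2) by (rule image_mono)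
  also have "\<dots> \<subseteq> cball 0 ((1 - \<delta>) * \<rho>)" using \<rho> by (auto simp: mult.commute)
  finally show ?thesis using us(1) by blast
qed

text \<open>Choose the symmetrizations such that the sum of the circumradii about the origin is close to its infimum over all
  finite sequences. If one of the bodies did not contain the ball of radius \<open>(1 - \<epsilon>)\<close> times its
  circumradius, further symmetrizations would shrink its circumradius by a fixed
  factor without enlarging the others, and the sum would fall below the infimum. Since volume does
  not decrease, the circumradius of the \<open>i\<close>-th body never falls below \<open>r i\<close>; this makes the gain
  \<open>\<delta> * m\<close> bounded away from zero and turns the balls found into balls of the required size.\<close>

lemma simultaneous_rounding:
  fixes K :: "'i \<Rightarrow> 'a::euclidean_space set"
  assumes I: "finite I" "I \<noteq> {}"
    and K: "\<And>i. i \<in> I \<Longrightarrow> compact (K i)" "\<And>i. i \<in> I \<Longrightarrow> convex (K i)"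
    and r: "\<And>i. i \<in> I \<Longrightarrow> 0 < r i" "\<And>i. i \<in> I \<Longrightarrow> emeasure lborel (cball (0::'a) (r i)) \<le> emeasure lborel (K i)"
    and \<epsilon>: "0 < \<epsilon>" "\<epsilon> < 1"
  obtains us where "\<forall>u\<in>set us. norm u = 1" "\<And>i. i \<in> I \<Longrightarrow> cball 0 ((1 - \<epsilon>) * r i) \<subseteq> steiners us (K i)"
proof -
  obtain \<delta> where \<delta>: "0 < \<delta>" "\<delta> < 1" "\<forall>\<theta>::'a. norm \<theta> = 1 \<longrightarrow>
     (\<exists>us. (\<forall>u\<in>set us. norm u = 1) \<and> steiners us (cball 0 1 \<inter> {x. x \<bullet> \<theta> \<le> 1 - \<epsilon>}) \<subseteq> cball 0 (1 - \<delta>))"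
    using steiners_shrink_uniform[OF \<epsilon>(1)] by blast
  define \<rho> where "\<rho> = (\<lambda>us i. Sup (norm ` steiners us (K i)))"
  have vol: "emeasure lborel (cball (0::'a) (r i)) \<le> emeasure lborel (steiners us (K i))"
    if "i \<in> I" "\<forall>u\<in>set us. norm u = 1" for i us
    using r(2)[OF that(1)] emeasure_le_steiners[OF K(1)[OF that(1)] K(2)[OF that(1)] that(2)] by (rule order_trans)
  have large: "r i \<le> c" if "i \<in> I" "\<forall>u\<in>set us. norm u = 1" "steiners us (K i) \<subseteq> cball 0 c" for i us c
  proof (rule ccontr)
    assume "\<not> r i \<le> c"
    then have lt: "max c 0 < r i" using r(1)[OF that(1)] by simp
    have "emeasure lborel (cball (0::'a) (r i)) \<le> emeasure lborel (cball (0::'a) (max c 0))"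
      by (intro order_trans[OF vol[OF that(1,2)]] emeasure_mono order_trans[OF that(3)]) auto
    moreover have "emeasure lborel (cball (0::'a) (max c 0)) < emeasure lborel (cball (0::'a) (r i))"
      using lt by (auto simp: emeasure_cball ennreal_less_iff intro!: mult_strict_left_mono power_strict_mono)
    ultimately show False by simp
  qed
  have cpt: "compact (steiners us (K i))" if "i \<in> I" for i us using compact_steiners K that by blast
  have ne: "steiners us (K i) \<noteq> {}" if "i \<in> I" "\<forall>u\<in>set us. norm u = 1" for i us
    using large[OF that, of 0] r(1)[OF that(1)] by fastforce
  have bdd: "bdd_above (norm ` steiners us (K i))" if i: "i \<in> I" for i us
  proof -
    obtain a where "\<forall>x\<in>steiners us (K i). norm x \<le> a"
      using compact_imp_bounded[OF cpt[OF i, of us]] unfolding bounded_iff by blast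
    then show ?thesis by (intro bdd_aboveI2[of _ _ a]) simp
  qed
  have in_cball: "steiners us (K i) \<subseteq> cball 0 (\<rho> us i)" if "i \<in> I" for i us
    using bdd[OF that, of us] by (auto simp: \<rho>_def intro!: cSup_upper)
  have least: "\<rho> us i \<le> c" if "i \<in> I" "\<forall>u\<in>set us. norm u = 1" "steiners us (K i) \<subseteq> cball 0 c" for us i c
    unfolding \<rho>_def using ne[OF that(1,2)] that(3) by (intro cSup_least) auto
  have r_le: "r i \<le> \<rho> us i" if "i \<in> I" "\<forall>u\<in>set us. norm u = 1" for us i
    using large[OF that in_cball[OF that(1)]] .
  let ?U = "{us :: 'a list. \<forall>u\<in>set us. norm u = 1}"
  define tot where "tot = (\<lambda>us. \<Sum>i\<in>I. \<rho> us i)"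
  define m where "m = Min (r ` I)"
  have m: "0 < m" "\<And>i. i \<in> I \<Longrightarrow> m \<le> r i" using I r(1) by (auto simp: m_def)
  have bddb: "bdd_below (tot ` ?U)"
    by (intro bdd_belowI2[of _ 0]) (auto simp: tot_def intro!: sum_nonneg order_trans[OF less_imp_le[OF r(1)] r_le])
  have "[] \<in> ?U" by simp
  then have "tot ` ?U \<noteq> {}" by blast
  moreover have "Inf (tot ` ?U) < Inf (tot ` ?U) + \<delta> * m" using \<delta>(1) m(1) by simp
  ultimately obtain us where us: "us \<in> ?U" "tot us < Inf (tot ` ?U) + \<delta> * m"
    using cInf_lessD[of "tot ` ?U"] by blast
  then have us1: "\<forall>u\<in>set us. norm u = 1" by simp
  have "cball 0 ((1 - \<epsilon>) * r j) \<subseteq> steiners us (K j)" if j: "j \<in> I" for j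
  proof -
    have \<rho>pos: "0 < \<rho> us j" using r_le[OF j us1] r(1)[OF j] by simp
    have "cball 0 ((1 - \<epsilon>) * \<rho> us j) \<subseteq> steiners us (K j)"
    proof (rule ccontr)
      assume "\<not> cball 0 ((1 - \<epsilon>) * \<rho> us j) \<subseteq> steiners us (K j)"
      then obtain vs where vs: "\<forall>u\<in>set vs. norm u = 1" "steiners vs (steiners us (K j)) \<subseteq> cball 0 ((1 - \<delta>) * \<rho> us j)"
        using steiners_shrink[OF \<delta>(3) cpt[OF j] convex_steiners[OF K(2)[OF j]] ne[OF j us1] in_cball[OF j] \<rho>pos] by blast
      let ?w = "us @ vs"
      have w: "\<forall>u\<in>set ?w. norm u = 1" using vs us1 by auto
      have le: "\<rho> ?w i \<le> \<rho> us i" if "i \<in> I" for i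
        using steiners_subset_cball[OF in_cball[OF that] vs(1)] by (intro least[OF that w]) simp
      have lej: "\<rho> ?w j \<le> (1 - \<delta>) * \<rho> us j" using vs(2) by (intro least[OF j w]) simp
      have "tot ?w = \<rho> ?w j + (\<Sum>i\<in>I - {j}. \<rho> ?w i)" unfolding tot_def by (rule sum.remove[OF I(1) j])
      also have "\<dots> \<le> (1 - \<delta>) * \<rho> us j + (\<Sum>i\<in>I - {j}. \<rho> us i)" using le lej by (intro add_mono sum_mono) auto
      also have "\<dots> = tot us - \<delta> * \<rho> us j" unfolding tot_def by (subst sum.remove[OF I(1) j]) (simp add: algebra_simps)
      also have "\<dots> \<le> tot us - \<delta> * m"
        using \<delta> m(2)[OF j] r_le[OF j us1] by (simp add: mult_left_mono)
      also have "\<dots> < Inf (tot ` ?U)" using us(2) by simp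
      also have "\<dots> \<le> tot ?w" using w by (intro cInf_lower bddb) auto
      finally show False by simp
    qed
    moreover have "cball (0::'a) ((1 - \<epsilon>) * r j) \<subseteq> cball 0 ((1 - \<epsilon>) * \<rho> us j)"
      using r_le[OF j us1] \<epsilon> by (intro subset_cball mult_left_mono) auto
    ultimately show ?thesis by blast
  qed
  with us1 that show ?thesis by blast
qed

lemma (in level_family) mass_le_steiners:
  "\<forall>u\<in>set us. norm u = 1 \<Longrightarrow> (\<And>i. i \<in> I \<Longrightarrow> z i \<in> steiners us (K i)) \<Longrightarrow>
    \<exists>x. (\<forall>i\<in>I. x i \<in> K i) \<and> mass z \<le> mass x"
proof (induction us arbitrary: z K)
  case Nil
  then show ?case by auto
next
  case (Cons u us)
  have "\<And>i. i \<in> I \<Longrightarrow> z i \<in> steiners us (steiner u (K i))" using Cons.prems(2) by simp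
  with Cons.prems(1) have "\<exists>x. (\<forall>i\<in>I. x i \<in> steiner u (K i)) \<and> mass z \<le> mass x"
    by (intro Cons.IH) simp_all
  then obtain y where y: "\<forall>i\<in>I. y i \<in> steiner u (K i)" "mass z \<le> mass y"
    by auto
  then obtain x where "\<And>i. i \<in> I \<Longrightarrow> x i \<in> K i" "mass y \<le> mass x"
    using mass_le_steiner[of u y K] Cons.prems by auto
  with y show ?case by force
qed

text \<open>After the rounding, the given points lie in the symmetrals; then the symmetrizations are undone
  one by one, from the last to the first, without losing mass.\<close>

lemma (in level_family) mass_le_of_balls:
  fixes K :: "'i \<Rightarrow> 'a::euclidean_space set" and z :: "'i \<Rightarrow> 'a"
  assumes K: "\<And>i. i \<in> I \<Longrightarrow> compact (K i)" "\<And>i. i \<in> I \<Longrightarrow> convex (K i)"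
    and r: "\<And>i. i \<in> I \<Longrightarrow> 0 < r i" "\<And>i. i \<in> I \<Longrightarrow> emeasure lborel (cball (0::'a) (r i)) \<le> emeasure lborel (K i)"
    and c: "0 < c" "c < 1" and z: "\<And>i. i \<in> I \<Longrightarrow> norm (z i) \<le> c * r i"
  obtains x where "\<And>i. i \<in> I \<Longrightarrow> x i \<in> K i" "mass z \<le> mass x"
proof -
  obtain us where us: "\<forall>u\<in>set us. norm u = 1" "\<And>i. i \<in> I \<Longrightarrow> cball 0 ((1 - (1 - c)) * r i) \<subseteq> steiners us (K i)"
    using simultaneous_rounding[of I K r "1 - c", OF finite_I nonempty_I K r] c by auto
  have "\<And>i. i \<in> I \<Longrightarrow> z i \<in> steiners us (K i)"
  proof -
    fix i assume i: "i \<in> I"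
    have "z i \<in> cball 0 ((1 - (1 - c)) * r i)" using z[OF i] by simp
    then show "z i \<in> steiners us (K i)" using us(2)[OF i] by blast
  qed
  then have "\<exists>x. (\<forall>i\<in>I. x i \<in> K i) \<and> mass z \<le> mass x"
    by (rule mass_le_steiners[OF us(1)])
  with that show ?thesis by blast
qed

section \<open>Break points and generating points\<close>

definition upward :: "('a::euclidean_space \<times> real) set \<Rightarrow> ('a \<times> real) set" where
  "upward S = {(x, t). \<exists>y\<le>t. (x, y) \<in> S}"

lemma upward_mono: "S \<subseteq> T \<Longrightarrow> upward S \<subseteq> upward T"
  by (auto simp: upward_def)

lemma upward_upward: "upward (upward S) = upward S"
  unfolding upward_def by (auto intro: order_trans)

lemma subset_upward: "S \<subseteq> upward S"
  by (auto simp: upward_def)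

lemma convex_upward:
  assumes "convex S"
  shows "convex (upward S)"
proof (rule convexI)
  fix p q k l assume "p \<in> upward S" "q \<in> upward S" and kl: "0 \<le> k" "0 \<le> l" "k + l = (1::real)"
  then obtain y z where yz: "y \<le> snd p" "(fst p, y) \<in> S" "z \<le> snd q" "(fst q, z) \<in> S"
    by (auto simp: upward_def)
  have "k *\<^sub>R (fst p, y) + l *\<^sub>R (fst q, z) \<in> S" by (rule convexD[OF assms yz(2,4) kl])
  moreover have "k * y + l * z \<le> k * snd p + l * snd q" using yz kl by (intro add_mono mult_left_mono)
  ultimately show "k *\<^sub>R p + l *\<^sub>R q \<in> upward S"
    unfolding upward_def by (auto simp: case_prod_unfold)
qed

text \<open>Otherwise the point would be the midpoint of a vertical segment.\<close>

lemma extreme_point_upward_lowest: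
  assumes "(x, t) extreme_point_of (upward S)" "(x, y) \<in> upward S"
  shows "t \<le> y"
proof (rule ccontr)
  assume "\<not> t \<le> y"
  then have lt: "y < t" by simp
  have "(x, t) \<in> upward S" using assms by (simp add: extreme_point_of_def)
  then obtain y0 where "y0 \<le> t" "(x, y0) \<in> S" by (auto simp: upward_def)
  then have "(x, 2 * t - y) \<in> upward S" using lt by (auto simp: upward_def intro!: exI[of _ y0])
  moreover have "(x, t) \<in> open_segment (x, y) (x, 2 * t - y)"
  proof -
    have "(x, t) = (1 - 1/2) *\<^sub>R (x, y) + (1/2) *\<^sub>R (x, 2 * t - y)"
      by (simp add: prod_eq_iff field_simps flip: scaleR_left_distrib)
    moreover have "(x, y) \<noteq> (x, 2 * t - y)" using lt by auto
    ultimately show ?thesis unfolding in_segment by (intro conjI exI[of _ "1/2"]) auto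
  qed
  ultimately show False using assms by (auto simp: extreme_point_of_def)
qed

lemma extreme_point_upward_hull:
  assumes "e extreme_point_of (upward (convex hull S))"
  shows "e \<in> S"
proof -
  obtain x t where e: "e = (x, t)" by (cases e)
  have "(x, t) \<in> upward (convex hull S)" using assms by (simp add: e extreme_point_of_def)
  then obtain y where y: "y \<le> t" "(x, y) \<in> convex hull S" by (auto simp: upward_def)
  then have "t \<le> y"
    using extreme_point_upward_lowest[OF assms[unfolded e]] subset_upward by blast
  with y have "e \<in> convex hull S" by (simp add: e)
  then have "e extreme_point_of (convex hull S)"
    using assms subset_upward[of "convex hull S"] by (auto simp: extreme_point_of_def)
  then show ?thesis by (rule extreme_point_of_convex_hull)
qed

text \<open>If \<open>S\<close> is empty, then \<open>u = 0\<close> and \<open>w\<close> carries no information.\<close>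

lemma upward_hull_insert_cases:
  assumes "a \<in> upward (convex hull (insert e S))"
  obtains u w s where "0 \<le> u" "u \<le> 1" "0 \<le> s" "u = 0 \<or> w \<in> convex hull S"
    "a = (1 - u) *\<^sub>R e + u *\<^sub>R w + (0, s)"
proof -
  obtain y where y: "y \<le> snd a" "(fst a, y) \<in> convex hull (insert e S)"
    using assms by (auto simp: upward_def)
  have a: "a = (fst a, y) + (0, snd a - y)" by (simp add: prod_eq_iff)
  show ?thesis
  proof (cases "S = {}")
    case True
    then have "(fst a, y) = e" using y by simp
    then show ?thesis using that[of 0 "snd a - y" e] a y by simp
  next
    case False
    from y(2) obtain u v b where uv: "0 \<le> u" "0 \<le> v" "u + v = 1" and b: "b \<in> convex hull S"
      and ab: "(fst a, y) = u *\<^sub>R e + v *\<^sub>R b"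
      unfolding convex_hull_insert[OF False] by blast
    have "u = 1 - v" using uv by simp
    then have "a = (1 - v) *\<^sub>R e + v *\<^sub>R b + (0, snd a - y)" using a ab by simp
    then show ?thesis using that[of v "snd a - y" b] uv b y(1) by simp
  qed
qed

text \<open>If \<open>e\<close> lies inside a segment from \<open>a\<close> to \<open>b\<close>, write both end points as combinations of \<open>e\<close>, a point
  of the hull of \<open>S\<close> and an upward vector, and solve the resulting equation for \<open>e\<close>. The total weight
  \<open>g\<close> of the points of \<open>S\<close> is positive, since otherwise \<open>a\<close> and \<open>b\<close> would both lie above \<open>e\<close>
  and their mixture could equal \<open>e\<close> only if they were equal. So \<open>e\<close> lies above the hull of \<open>S\<close>.\<close>

lemma upward_hull_remove_nonextreme:
  assumes not: "\<not> e extreme_point_of (upward (convex hull (insert e S)))"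
  shows "upward (convex hull (insert e S)) = upward (convex hull S)"
proof
  let ?P = "upward (convex hull (insert e S))"
  have "e \<in> ?P" using hull_inc[of e "insert e S"] subset_upward by blast
  then obtain a b where ab: "a \<in> ?P" "b \<in> ?P" "e \<in> open_segment a b"
    using not by (auto simp: extreme_point_of_def)
  then obtain m where m: "0 < m" "m < 1" and m_eq: "e = (1 - m) *\<^sub>R a + m *\<^sub>R b" and "a \<noteq> b"
    by (auto simp: in_segment)
  obtain u w s where a: "0 \<le> u" "u \<le> 1" "0 \<le> s"
      and a_hull: "u = 0 \<or> w \<in> convex hull S" and a_eq: "a = (1 - u) *\<^sub>R e + u *\<^sub>R w + (0, s)"
    using ab(1) by (rule upward_hull_insert_cases)
  obtain v w' r where b: "0 \<le> v" "v \<le> 1" "0 \<le> r"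
      and b_hull: "v = 0 \<or> w' \<in> convex hull S" and b_eq: "b = (1 - v) *\<^sub>R e + v *\<^sub>R w' + (0, r)"
    using ab(2) by (rule upward_hull_insert_cases)
  define g where "g = (1 - m) * u + m * v"
  define \<tau> where "\<tau> = (1 - m) * s + m * r"
  have "0 \<le> \<tau>" using a b m by (simp add: \<tau>_def)
  have "e = (1 - m) *\<^sub>R ((1 - u) *\<^sub>R e + u *\<^sub>R w + (0, s)) + m *\<^sub>R ((1 - v) *\<^sub>R e + v *\<^sub>R w' + (0, r))"
    using m_eq unfolding a_eq[symmetric] b_eq[symmetric] .
  also have "\<dots> = e - g *\<^sub>R e + (((1 - m) * u) *\<^sub>R w + (m * v) *\<^sub>R w') + (0, \<tau>)"
    by (simp add: prod_eq_iff g_def \<tau>_def algebra_simps)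
  finally have eq: "g *\<^sub>R e = ((1 - m) * u) *\<^sub>R w + (m * v) *\<^sub>R w' + (0, \<tau>)" by (simp add: algebra_simps)
  have "g \<noteq> 0"
  proof
    assume "g = 0"
    moreover have "0 \<le> (1 - m) * u" "0 \<le> m * v" using a b m by auto
    ultimately have "(1 - m) * u = 0" "m * v = 0" unfolding g_def by (metis add_nonneg_eq_0_iff)+
    then have uv: "u = 0" "v = 0" using m by auto
    then have "(0, \<tau>) = (0 :: 'a \<times> real)" using eq \<open>g = 0\<close> by simp
    then have "\<tau> = 0" by (simp add: zero_prod_def)
    moreover have "0 \<le> (1 - m) * s" "0 \<le> m * r" using a b m by auto
    ultimately have "(1 - m) * s = 0" "m * r = 0" unfolding \<tau>_def by (metis add_nonneg_eq_0_iff)+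
    then have "s = 0" "r = 0" using m by auto
    have "a = e" "b = e" unfolding a_eq b_eq \<open>s = 0\<close> \<open>r = 0\<close> uv by (simp_all flip: zero_prod_def)
    with \<open>a \<noteq> b\<close> show False by simp
  qed
  then have "0 < g" using a b m by (auto simp: g_def less_le)
  define x where "x = ((1 - m) * u / g) *\<^sub>R w + (m * v / g) *\<^sub>R w'"
  have "e = (1 / g) *\<^sub>R (g *\<^sub>R e)" using \<open>0 < g\<close> by simp
  also have "\<dots> = x + (0, \<tau> / g)" unfolding eq x_def scaleR_right_distrib scaleR_scaleR by simp
  finally have e: "e = x + (0, \<tau> / g)" .
  have sum1: "(1 - m) * u / g + m * v / g = 1" using \<open>0 < g\<close> by (simp add: g_def flip: add_divide_distrib)
  have "x \<in> convex hull S"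
  proof -
    consider "u = 0" | "v = 0" | "w \<in> convex hull S" "w' \<in> convex hull S" using a_hull b_hull by blast
    then show ?thesis
    proof cases
      case 1
      then have mv: "m * v / g = 1" and "v \<noteq> 0" using sum1 by auto
      have "x = w'" unfolding x_def mv 1 by simp
      with \<open>v \<noteq> 0\<close> b_hull show ?thesis by simp
    next
      case 2
      then have mu: "(1 - m) * u / g = 1" and "u \<noteq> 0" using sum1 by auto
      have "x = w" unfolding x_def mu 2 by simp
      with \<open>u \<noteq> 0\<close> a_hull show ?thesis by simp
    next
      case 3
      moreover have "0 \<le> (1 - m) * u / g" "0 \<le> m * v / g" using a b m \<open>0 < g\<close> by simp_all
      ultimately show ?thesis unfolding x_def by (intro convexD[OF convex_convex_hull _ _ _ _ sum1])
    qed
  qed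
  then have "(fst x, snd x) \<in> convex hull S" by simp
  moreover have "snd x \<le> snd x + \<tau> / g" using \<open>0 \<le> \<tau>\<close> \<open>0 < g\<close> by simp
  ultimately have "(fst x, snd x + \<tau> / g) \<in> upward (convex hull S)" unfolding upward_def by blast
  moreover have "e = (fst x, snd x + \<tau> / g)" using e by (simp add: prod_eq_iff)
  ultimately have "e \<in> upward (convex hull S)" by simp
  moreover have "S \<subseteq> upward (convex hull S)" by (rule order_trans[OF hull_subset subset_upward])
  ultimately have "convex hull (insert e S) \<subseteq> upward (convex hull S)"
    by (intro hull_minimal convex_upward convex_convex_hull) simp
  then have "?P \<subseteq> upward (upward (convex hull S))" by (rule upward_mono)
  then show "?P \<subseteq> upward (convex hull S)" unfolding upward_upward .
  show "upward (convex hull S) \<subseteq> ?P" by (intro upward_mono hull_mono) auto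
qed

lemma ereal_eq_by_upper_reals:
  assumes "\<And>t. a \<le> ereal t \<longleftrightarrow> b \<le> ereal t"
  shows "a = b"
  by (rule antisym; rule ereal_le_real; simp only: assms; simp)

context hypo_points begin

lemma epi_inner_lin_base: "epi (inner_lin_base \<alpha> Y) = upward (convex hull base_points \<alpha> Y)"
  by (simp add: epi_def upward_def inner_lin_base_le_iff)

text \<open>Every extreme point of the epigraph is one of the lifted generating points.\<close>

lemma break_points_card_le:
  "finite (break_points (inner_lin_base \<alpha> Y)) \<and> card (break_points (inner_lin_base \<alpha> Y)) \<le> card Y"
proof -
  have "break_points (inner_lin_base \<alpha> Y) \<subseteq> fst ` base_points \<alpha> Y"
    using extreme_point_upward_hull unfolding break_points_def epi_inner_lin_base by force
  then have "break_points (inner_lin_base \<alpha> Y) \<subseteq> fst ` Y" by (simp add: fst_base_points)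
  then show ?thesis using finite
    by (meson card_image_le card_mono finite_imageI finite_subset order_trans)
qed

text \<open>Take a generating set of minimal size. None of its points can be removed, so each of them is
  lifted to an extreme point of the epigraph, and distinct generating points have distinct
  positions, because an extreme point is the lowest point above its position.\<close>

lemma break_points_reduce:
  obtains Z where "Z \<subseteq> Y" "Z \<noteq> {}" "inner_lin_base \<alpha> Z = inner_lin_base \<alpha> Y"
    "finite (break_points (inner_lin_base \<alpha> Y)) \<Longrightarrow> card Z \<le> card (break_points (inner_lin_base \<alpha> Y))"
proof -
  let ?up = "\<lambda>Z. upward (convex hull base_points \<alpha> Z)"
  let ?good = "\<lambda>Z. Z \<subseteq> Y \<and> Z \<noteq> {} \<and> ?up Z = ?up Y"
  have "?good Y" using nonempty by simp
  then obtain Z where Z: "?good Z" and min: "\<And>Z'. ?good Z' \<Longrightarrow> card Z \<le> card Z'"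
    using ex_has_least_nat[of ?good Y card] by blast
  have finZ: "finite Z" using Z finite finite_subset by blast
  interpret Z: hypo_points Z using Z finZ pos by unfold_locales auto
  have same: "inner_lin_base \<alpha> Z = inner_lin_base \<alpha> Y"
  proof
    fix x
    have "inner_lin_base \<alpha> Z x \<le> ereal t \<longleftrightarrow> inner_lin_base \<alpha> Y x \<le> ereal t" for t
      using Z epi_inner_lin_base[of \<alpha>] Z.epi_inner_lin_base[of \<alpha>] unfolding epi_def by blast
    then show "inner_lin_base \<alpha> Z x = inner_lin_base \<alpha> Y x" by (rule ereal_eq_by_upper_reals)
  qed
  have ext: "(x, base_val \<alpha> s) extreme_point_of (?up Y)" if z: "(x, s) \<in> Z" for x s
  proof (rule ccontr)
    assume not: "\<not> (x, base_val \<alpha> s) extreme_point_of (?up Y)"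
    let ?Z = "Z - {(x, s)}"
    have ins: "base_points \<alpha> Z = insert (x, base_val \<alpha> s) (base_points \<alpha> ?Z)"
      using z by (force simp: base_points_def)
    have up_eq: "?up Z = ?up ?Z"
      unfolding ins using Z not by (intro upward_hull_remove_nonextreme) (simp add: ins)
    have "(x, base_val \<alpha> s) \<in> convex hull base_points \<alpha> Z" by (rule hull_inc) (simp add: ins)
    then have "?up Z \<noteq> {}" using subset_upward by blast
    moreover have "?up {} = {}" by (simp add: base_points_def upward_def)
    ultimately have "?Z \<noteq> {}" using up_eq by metis
    then have "?good ?Z" using Z up_eq by blast
    then have "card Z \<le> card ?Z" by (rule min)
    then show False using finZ z by (metis card_Diff1_less not_le)
  qed
  have "card Z \<le> card (break_points (inner_lin_base \<alpha> Y))" if fin: "finite (break_points (inner_lin_base \<alpha> Y))"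
  proof (rule card_inj_on_le[of fst, OF _ _ fin])
    show "fst ` Z \<subseteq> break_points (inner_lin_base \<alpha> Y)"
      using ext by (force simp: break_points_def epi_inner_lin_base)
    show "inj_on fst Z"
    proof (rule inj_onI)
      fix z z' assume *: "z \<in> Z" "z' \<in> Z" "fst z = fst z'"
      obtain x s s' where z: "z = (x, s)" "z' = (x, s')" using *(3) by (cases z; cases z') simp
      have e: "(x, base_val \<alpha> s) extreme_point_of (?up Y)" "(x, base_val \<alpha> s') extreme_point_of (?up Y)"
        using ext *(1,2) unfolding z by blast+
      then have "(x, base_val \<alpha> s) \<in> ?up Y" "(x, base_val \<alpha> s') \<in> ?up Y"
        unfolding extreme_point_of_def by blast+
      then have "base_val \<alpha> s = base_val \<alpha> s'"
        using e extreme_point_upward_lowest by (intro order_antisym) blast+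
      then show "z = z'" using *(1,2) Z.pos unfolding z by (simp add: base_val_eq_iff)
    qed
  qed
  with Z same that show ?thesis by blast
qed

end

section \<open>Concave functions and their rearrangements\<close>

text \<open>The epigraph of the base function, which is \<open>\<infinity>\<close> where \<open>f\<close> vanishes.\<close>

definition base_epi :: "real \<Rightarrow> ('a::euclidean_space \<Rightarrow> real) \<Rightarrow> ('a \<times> real) set" where
  "base_epi \<alpha> f = {(x, y). f x \<noteq> 0 \<and> base_val \<alpha> (f x) \<le> y}"

lemma convex_base_epi:
  assumes nonneg: "\<And>x. 0 \<le> f x" and conc: "alpha_concave \<alpha> f"
  shows "convex (base_epi \<alpha> f)"
proof (rule convexI)
  fix p q k l assume pq: "p \<in> base_epi \<alpha> f" "q \<in> base_epi \<alpha> f" and kl: "0 \<le> k" "0 \<le> l" "k + l = (1::real)"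
  obtain x y x' y' where p: "p = (x, y)" and q: "q = (x', y')" by (cases p; cases q)
  have s: "x \<in> supp f" "x' \<in> supp f" and y: "base_val \<alpha> (f x) \<le> y" "base_val \<alpha> (f x') \<le> y'"
    using pq by (auto simp: p q base_epi_def supp_def)
  have fpos: "0 < f x" "0 < f x'" using s nonneg[of x] nonneg[of x'] by (auto simp: supp_def)
  let ?z = "k *\<^sub>R x + l *\<^sub>R x'"
  have l: "l = 1 - k" using kl by simp
  have "?z \<in> supp f" using conc s kl unfolding alpha_concave_def by (auto intro: convexD)
  then have fz: "0 < f ?z" using nonneg[of ?z] by (auto simp: supp_def)
  define M where "M = (if \<alpha> = 0 then f x powr k * f x' powr l else (k * f x powr \<alpha> + l * f x' powr \<alpha>) powr (1 / \<alpha>))"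
  have "M \<le> f ?z"
    using conc s kl unfolding alpha_concave_def M_def l by simp
  have "0 < k * f x powr \<alpha> + l * f x' powr \<alpha>"
  proof (cases "k = 0")
    case False
    then have "0 < k * f x powr \<alpha>" using kl fpos by simp
    then show ?thesis using kl fpos by (simp add: add_pos_nonneg)
  qed (use kl fpos in simp)
  then have "0 < M" and base_M: "base_val \<alpha> M = k * base_val \<alpha> (f x) + l * base_val \<alpha> (f x')"
    using fpos unfolding M_def base_val_def by (auto simp: ln_mult powr_powr l field_simps)
  have "base_val \<alpha> (f ?z) \<le> base_val \<alpha> M" using \<open>M \<le> f ?z\<close> \<open>0 < M\<close> fz by (simp add: base_val_le_iff)
  also have "\<dots> \<le> k * y + l * y'" unfolding base_M using y kl by (intro add_mono mult_left_mono)
  finally show "k *\<^sub>R p + l *\<^sub>R q \<in> base_epi \<alpha> f" using fz by (simp add: p q base_epi_def)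
qed

lemma mem_base_epi_iff:
  assumes "\<And>x. 0 \<le> f x" "0 < t"
  shows "(x, base_val \<alpha> t) \<in> base_epi \<alpha> f \<longleftrightarrow> t \<le> f x"
proof (cases "f x = 0")
  case False
  then have "0 < f x" using assms(1)[of x] by simp
  then show ?thesis using assms(2) by (simp add: base_epi_def base_val_le_iff)
qed (use assms in \<open>simp add: base_epi_def\<close>)

locale alpha_concave_function =
  fixes \<alpha> :: real and f :: "'a::euclidean_space \<Rightarrow> real"
  assumes f: "f \<in> C_class \<alpha>"
begin

lemma nonneg: "0 \<le> f x" and concave: "alpha_concave \<alpha> f" and usc: "upper_semicontinuous f"
  and f_integrable: "integrable lebesgue f" and full_dim: "aff_dim (supp f) = int DIM('a)"
  and origin: "0 < f 0" and decay: "(f \<longlongrightarrow> 0) at_infinity"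
  using f unfolding C_class_def by (auto simp: supp_def less_le)

lemma mem_epi_iff: "0 < t \<Longrightarrow> (x, base_val \<alpha> t) \<in> base_epi \<alpha> f \<longleftrightarrow> t \<le> f x"
  using mem_base_epi_iff[of f t x \<alpha>] nonneg by blast

abbreviation level :: "real \<Rightarrow> 'a set" where "level t \<equiv> {x. t \<le> f x}"

lemma convex_level:
  assumes "0 < t"
  shows "convex (level t)"
proof (rule convexI)
  fix x y k l assume xy: "x \<in> level t" "y \<in> level t" and kl: "0 \<le> k" "0 \<le> l" "k + l = (1::real)"
  have "k *\<^sub>R (x, base_val \<alpha> t) + l *\<^sub>R (y, base_val \<alpha> t) \<in> base_epi \<alpha> f"
    using xy mem_epi_iff[OF assms]
    by (intro convexD[OF convex_base_epi[OF nonneg concave] _ _ kl]) simp_all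
  moreover have "k *\<^sub>R (x, base_val \<alpha> t) + l *\<^sub>R (y, base_val \<alpha> t) = (k *\<^sub>R x + l *\<^sub>R y, base_val \<alpha> t)"
    using kl by (simp flip: distrib_right)
  ultimately show "k *\<^sub>R x + l *\<^sub>R y \<in> level t"
    using mem_epi_iff[OF assms] by simp
qed

lemma compact_level:
  assumes "0 < t"
  shows "compact (level t)"
proof -
  have "open {x. f x < t}"
  proof (subst open_subopen, intro ballI)
    fix x assume "x \<in> {x. f x < t}"
    then have "eventually (\<lambda>y. f y < t) (at x)" "f x < t" using usc by (auto simp: upper_semicontinuous_def)
    then have "eventually (\<lambda>y. f y < t) (nhds x)" unfolding eventually_at_filter by (auto elim!: eventually_mono)
    then show "\<exists>T. open T \<and> x \<in> T \<and> T \<subseteq> {x. f x < t}" unfolding eventually_nhds by blast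
  qed
  then have "closed (- {x. f x < t})" by (rule closed_Compl)
  moreover have "- {x. f x < t} = level t" by auto
  moreover have "bounded (level t)"
  proof -
    have "eventually (\<lambda>x. f x < t) at_infinity" using decay assms by (rule order_tendstoD)
    then obtain b where b: "\<And>x. b \<le> norm x \<Longrightarrow> f x < t" unfolding eventually_at_infinity by blast
    have "norm x \<le> b" if "x \<in> level t" for x using b[of x] that by fastforce
    then show ?thesis unfolding bounded_iff by blast
  qed
  ultimately show ?thesis by (simp add: compact_eq_bounded_closed)
qed

lemma borel_measurable_f [measurable]: "f \<in> borel_measurable borel"
  by (rule borel_measurable_of_superlevels) (auto simp: nonneg compact_level compact_imp_borel)

text \<open>The support has nonempty interior, and it is a countable union of convex superlevel sets;
  they cannot all be negligible.\<close>

lemma fat_level: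
  obtains d x r where "0 < d" "0 < (r::real)" "ball x r \<subseteq> level d"
proof -
  have "affine hull (supp f) = UNIV" using full_dim by (simp add: aff_dim_eq_full)
  moreover have "rel_interior (supp f) \<noteq> {}"
    using concave origin by (subst rel_interior_eq_empty) (auto simp: alpha_concave_def supp_def intro!: exI[of _ 0])
  ultimately have "interior (supp f) \<noteq> {}" by (simp add: rel_interior_interior)
  moreover have "convex (supp f)" using concave by (simp add: alpha_concave_def)
  ultimately have "\<not> negligible (supp f)" by (simp add: negligible_convex_interior)
  moreover have "supp f = (\<Union>k::nat. level (1 / Suc k))"
  proof (intro equalityI subsetI)
    fix x assume "x \<in> supp f"
    then have "0 < f x" using nonneg[of x] by (simp add: supp_def)
    then obtain k where "1 / Suc k < f x" using nat_approx_posE by metis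
    then show "x \<in> (\<Union>k::nat. level (1 / Suc k))" by (auto intro!: exI[of _ k])
  next
    fix x assume "x \<in> (\<Union>k::nat. level (1 / Suc k))"
    then obtain k :: nat where "1 / Suc k \<le> f x" by auto
    moreover have "0 < 1 / real (Suc k)" by simp
    ultimately show "x \<in> supp f" unfolding supp_def by force
  qed
  ultimately obtain k :: nat where "\<not> negligible (level (1 / Suc k))"
    using negligible_countable_Union[of "range (\<lambda>k. level (1 / Suc k))"] by auto
  then have "interior (level (1 / Suc k)) \<noteq> {}" by (simp add: negligible_convex_interior convex_level)
  then obtain x r where "0 < r" "ball x r \<subseteq> level (1 / Suc k)" by (auto simp: mem_interior)
  then show ?thesis using that[of "1 / Suc k"] by simp
qed

text \<open>A superlevel set may be a single point, for instance at the maximum of \<open>f\<close>. Moving slightly from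
  a point at level \<open>s\<close> towards a ball in the support loses little height, by convexity of the
  base function, so every lower level contains a small copy of this ball.\<close>

lemma lower_level_fat:
  assumes s: "0 < s" "level s \<noteq> {}" and c: "0 < c" "c < 1"
  shows "0 < measure lebesgue (level (c * s))"
proof -
  obtain x0 where x0: "s \<le> f x0" using s by auto
  obtain d x r where d: "0 < d" "0 < r" "ball x r \<subseteq> level d" by (rule fat_level)
  define D where "D = base_val \<alpha> (c * s) - base_val \<alpha> s"
  define B where "B = base_val \<alpha> d - base_val \<alpha> s"
  have cs: "0 < c * s" using s c by simp
  have "0 < D"
  proof -
    have "\<not> base_val \<alpha> (c * s) \<le> base_val \<alpha> s" using s c by (simp add: base_val_le_iff)
    then show ?thesis by (simp add: D_def)
  qed
  \<comment> \<open>The step towards the ball: \<open>m * B\<close> is the loss in base value and \<open>D\<close> is the admissible loss.\<close>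
  define m where "m = D / (D + \<bar>B\<bar>)"
  have m: "0 < m" "m \<le> 1" using \<open>0 < D\<close> by (auto simp: m_def)
  have "m * B \<le> D"
  proof -
    have "m * B \<le> m * (D + \<bar>B\<bar>)" using m \<open>0 < D\<close> by (intro mult_left_mono) auto
    also have "\<dots> = D" using \<open>0 < D\<close> by (simp add: m_def)
    finally show ?thesis .
  qed
  have "ball ((1 - m) *\<^sub>R x0 + m *\<^sub>R x) (m * r) \<subseteq> level (c * s)"
  proof
    fix z assume z: "z \<in> ball ((1 - m) *\<^sub>R x0 + m *\<^sub>R x) (m * r)"
    define w where "w = (1 / m) *\<^sub>R (z - (1 - m) *\<^sub>R x0)"
    have zw: "z = (1 - m) *\<^sub>R x0 + m *\<^sub>R w" using m by (simp add: w_def)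
    have "m * norm (x - w) = norm (m *\<^sub>R (x - w))" using m by simp
    also have "m *\<^sub>R (x - w) = ((1 - m) *\<^sub>R x0 + m *\<^sub>R x) - z" by (simp add: zw algebra_simps)
    finally have "m * norm (x - w) < m * r" using z by (simp add: dist_norm)
    then have "w \<in> ball x r" using m by (simp add: dist_norm)
    then have "d \<le> f w" using d by blast
    have "(1 - m) *\<^sub>R (x0, base_val \<alpha> s) + m *\<^sub>R (w, base_val \<alpha> d) \<in> base_epi \<alpha> f"
      using m x0 \<open>d \<le> f w\<close> mem_epi_iff[OF s(1)] mem_epi_iff[OF d(1)]
      by (intro convexD[OF convex_base_epi[OF nonneg concave]]) simp_all
    then have "f z \<noteq> 0" "base_val \<alpha> (f z) \<le> (1 - m) * base_val \<alpha> s + m * base_val \<alpha> d"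
      by (simp_all add: base_epi_def zw)
    moreover have "(1 - m) * base_val \<alpha> s + m * base_val \<alpha> d = base_val \<alpha> s + m * B"
      by (simp add: B_def algebra_simps)
    ultimately have "base_val \<alpha> (f z) \<le> base_val \<alpha> (c * s)" "0 < f z"
      using \<open>m * B \<le> D\<close> nonneg[of z] by (auto simp: D_def less_le)
    then show "z \<in> level (c * s)" using cs by (simp add: base_val_le_iff)
  qed
  then have "((1 - m) *\<^sub>R x0 + m *\<^sub>R x) \<in> interior (level (c * s))"
    using m d by (intro interiorI[of "ball ((1 - m) *\<^sub>R x0 + m *\<^sub>R x) (m * r)"]) auto
  then have "\<not> negligible (level (c * s))" by (subst negligible_convex_interior) (auto simp: convex_level cs)
  moreover have "level (c * s) \<in> lmeasurable" using compact_level[OF cs] by (rule lmeasurable_compact)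
  ultimately show ?thesis by (metis measure_nonneg less_le negligible_iff_measure)
qed

end

lemma ex1_ball_radius:
  assumes "0 \<le> m"
  shows "\<exists>!r. 0 \<le> r \<and> measure lebesgue (cball (0::'a::euclidean_space) r) = m"
proof -
  define v where "v = unit_ball_vol (real DIM('a))"
  have v: "0 < v" by (simp add: v_def)
  have content: "measure lebesgue (cball (0::'a) r) = v * r ^ DIM('a)" if "0 \<le> r" for r
    using content_cball[OF that, of "0::'a"] by (simp add: v_def)
  let ?r = "root DIM('a) (m / v)"
  show ?thesis
  proof (rule ex1I)
    have r0: "0 \<le> ?r" using assms v by simp
    have "?r ^ DIM('a) = m / v" using assms v by simp
    then have "measure lebesgue (cball (0::'a) ?r) = m" unfolding content[OF r0] using v by simp
    with r0 show "0 \<le> ?r \<and> measure lebesgue (cball (0::'a) ?r) = m" by blast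
    show "r = ?r" if r: "0 \<le> r \<and> measure lebesgue (cball (0::'a) r) = m" for r
    proof -
      have "v * r ^ DIM('a) = m" using content[of r] r by metis
      then have "m / v = r ^ DIM('a)" using v by auto
      then show ?thesis using r by (simp add: real_root_power_cancel)
    qed
  qed
qed

lemma content_cball_le_iff:
  assumes "0 \<le> r" "0 \<le> s"
  shows "measure lebesgue (cball (0::'a::euclidean_space) r) \<le> measure lebesgue (cball (0::'a) s) \<longleftrightarrow> r \<le> s"
  using assms by (simp add: content_cball power_mono_iff)

lemma sym_ball_eq_cball:
  fixes A :: "'a::euclidean_space set"
  assumes "A \<noteq> {}"
  obtains r where "0 \<le> r" "measure lebesgue (cball (0::'a) r) = measure lebesgue A" "sym_ball A = cball 0 r"
proof -
  define r where "r = (THE r. 0 \<le> r \<and> measure lebesgue (cball (0::'a) r) = measure lebesgue A)"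
  have "0 \<le> r \<and> measure lebesgue (cball (0::'a) r) = measure lebesgue A"
    unfolding r_def by (rule theI'[OF ex1_ball_radius]) (rule measure_nonneg)
  moreover have "sym_ball A = cball 0 r" using assms by (simp only: sym_ball_def r_def if_False)
  ultimately show ?thesis using that by blast
qed

text \<open>Comparing volumes instead of radii avoids the radius, which is defined by description, in all limit arguments.\<close>

lemma mem_sym_ball_iff:
  fixes A :: "'a::euclidean_space set"
  shows "x \<in> sym_ball A \<longleftrightarrow> A \<noteq> {} \<and> measure lebesgue (cball (0::'a) (norm x)) \<le> measure lebesgue A"
proof (cases "A = {}")
  case False
  from sym_ball_eq_cball[OF this] obtain r where r: "0 \<le> r"
    "measure lebesgue (cball (0::'a) r) = measure lebesgue A" "sym_ball A = cball 0 r" .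
  show ?thesis using False content_cball_le_iff[where 'a='a, of "norm x" r] r by simp
qed (simp add: sym_ball_def)

lemma measure_sym_ball: "measure lebesgue (sym_ball A) = measure lebesgue A"
proof (cases "A = {}")
  case False
  then show ?thesis by (metis sym_ball_eq_cball)
qed (simp add: sym_ball_def)

lemma compact_sym_ball: "compact (sym_ball A)"
  by (cases "A = {}") (auto simp: sym_ball_def)

text \<open>A decreasing, eventually empty family of sets that is continuous from the left consists of the superlevel sets
  of a unique function, namely of the supremum of the levels at which a point is present. The
  default value 0 covers the points that belong to no set of the family.\<close>

lemma ex_function_with_superlevels:
  fixes P :: "real \<Rightarrow> 'a set"
  assumes anti: "\<And>s t. 0 < s \<Longrightarrow> s \<le> t \<Longrightarrow> P t \<subseteq> P s"
    and left: "\<And>t x. 0 < t \<Longrightarrow> (\<And>s. 0 < s \<Longrightarrow> s < t \<Longrightarrow> x \<in> P s) \<Longrightarrow> x \<in> P t"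
    and bound: "\<And>t. T \<le> t \<Longrightarrow> P t = {}" and T: "0 < T"
  shows "\<exists>!h::'a \<Rightarrow> real. (\<forall>x. 0 \<le> h x) \<and> (\<forall>t>0. {x. h x \<ge> t} = P t)"
proof (rule ex_ex1I)
  define S where "S x = insert 0 {t. 0 < t \<and> x \<in> P t}" for x
  have bdd: "bdd_above (S x)" for x
  proof (rule bdd_aboveI[of _ T])
    fix t assume t: "t \<in> S x"
    show "t \<le> T"
    proof (cases "t = 0")
      case False
      then have "P t \<noteq> {}" using t by (auto simp: S_def)
      then show ?thesis using bound[of t] by linarith
    qed (use T in simp)
  qed
  have nonneg: "0 \<le> Sup (S x)" for x by (rule cSup_upper[OF _ bdd]) (simp add: S_def)
  have "t \<le> Sup (S x) \<longleftrightarrow> x \<in> P t" if t: "0 < t" for t x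
  proof
    assume "x \<in> P t"
    then show "t \<le> Sup (S x)" using t by (intro cSup_upper[OF _ bdd]) (simp add: S_def)
  next
    assume le: "t \<le> Sup (S x)"
    show "x \<in> P t"
    proof (rule left[OF t])
      fix s assume s: "0 < s" "s < t"
      then have "s < Sup (S x)" using le by simp
      then obtain r where "r \<in> S x" "s < r" using less_cSup_iff[OF _ bdd] by (auto simp: S_def)
      then show "x \<in> P s" using s anti[of s r] by (auto simp: S_def)
    qed
  qed
  then show "\<exists>h::'a \<Rightarrow> real. (\<forall>x. 0 \<le> h x) \<and> (\<forall>t>0. {x. h x \<ge> t} = P t)"
    using nonneg by (intro exI[of _ "\<lambda>x. Sup (S x)"]) auto
next
  fix h k :: "'a \<Rightarrow> real"
  assume h: "(\<forall>x. 0 \<le> h x) \<and> (\<forall>t>0. {x. h x \<ge> t} = P t)" and k: "(\<forall>x. 0 \<le> k x) \<and> (\<forall>t>0. {x. k x \<ge> t} = P t)"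
  have iff: "t \<le> h x \<longleftrightarrow> t \<le> k x" if "0 < t" for t x using h k that by blast
  show "h = k"
  proof
    fix x
    show "h x = k x"
      using iff[of "h x" x] iff[of "k x" x] h k by (metis antisym less_le order_refl)
  qed
qed

lemma emeasure_compact:
  fixes A :: "'a::euclidean_space set"
  assumes "compact A"
  shows "emeasure lborel A = ennreal (measure lebesgue A)"
  using compact_imp_borel[OF assms] emeasure_bounded_finite[OF compact_imp_bounded[OF assms]]
  by (simp add: emeasure_eq_ennreal_measure)

context alpha_concave_function begin

lemma sym_ball_level_antimono:
  assumes "0 < s" "s \<le> t"
  shows "sym_ball (level t) \<subseteq> sym_ball (level s)"
proof
  fix x assume x: "x \<in> sym_ball (level t)"
  have "measure lebesgue (level t) \<le> measure lebesgue (level s)"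
    using assms by (intro measure_mono_fmeasurable) (auto intro!: lmeasurable_compact compact_level fmeasurableD)
  then show "x \<in> sym_ball (level s)" using x assms by (auto simp: mem_sym_ball_iff intro: order_trans)
qed

text \<open>Left continuity of the family of balls comes from continuity of the volume along a decreasing
  sequence of compact sets; nested nonempty compact sets also have a common point, so that
  the ball at level \<open>t\<close> is not empty.\<close>

lemma sym_ball_level_left_closed:
  assumes t: "0 < t" and x: "\<And>s. 0 < s \<Longrightarrow> s < t \<Longrightarrow> x \<in> sym_ball (level s)"
  shows "x \<in> sym_ball (level t)"
proof -
  define s where "s k = t - t / (real k + 2)" for k
  have s: "0 < s k" "s k < t" for k using t by (auto simp: s_def field_simps add_pos_nonneg)
  have mono: "s k \<le> s l" if "k \<le> l" for k l
    using t that by (auto simp: s_def intro!: divide_left_mono)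
  have INT: "(\<Inter>k. level (s k)) = level t"
  proof (intro equalityI subsetI)
    fix y assume "y \<in> (\<Inter>k. level (s k))"
    then have "\<And>k. s k \<le> f y" by auto
    moreover have "s \<longlonglongrightarrow> t - 0" unfolding s_def
      by (intro tendsto_diff tendsto_const tendsto_divide_0[OF tendsto_const] filterlim_at_top_imp_at_infinity)
         (rule filterlim_tendsto_add_at_top[OF tendsto_const filterlim_real_sequentially, of 2, simplified add.commute])
    ultimately show "y \<in> level t" by (auto intro: LIMSEQ_le_const2)
  next
    fix y assume "y \<in> level t"
    then show "y \<in> (\<Inter>k. level (s k))" using s(2) by (auto intro: order_trans less_imp_le)
  qed
  have ne: "level (s k) \<noteq> {}" and le: "measure lebesgue (cball (0::'a) (norm x)) \<le> measure lebesgue (level (s k))" for k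
    using x[OF s, of k] by (auto simp: mem_sym_ball_iff)
  have dec: "level (s l) \<subseteq> level (s k)" if "k \<le> l" for k l using mono[OF that] by auto
  have "(\<Inter>k. level (s k)) \<noteq> {}" by (rule compact_nest[OF compact_level[OF s(1)] ne dec])
  moreover have "(\<lambda>k. measure lebesgue (level (s k))) \<longlonglongrightarrow> measure lebesgue (\<Inter>k. level (s k))"
  proof (rule Lim_measure_decseq)
    have meas: "level (s k) \<in> lmeasurable" for k using compact_level[OF s(1)] by (rule lmeasurable_compact)
    show "range (\<lambda>k. level (s k)) \<subseteq> sets lebesgue" using fmeasurableD[OF meas] by blast
    show "decseq (\<lambda>k. level (s k))" unfolding decseq_def using dec by blast
    show "emeasure lebesgue (level (s k)) \<noteq> \<infinity>" for k using fmeasurableD2[OF meas] by simp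
  qed
  then have "measure lebesgue (cball (0::'a) (norm x)) \<le> measure lebesgue (\<Inter>k. level (s k))"
    by (rule LIMSEQ_le_const) (use le in blast)
  ultimately show ?thesis unfolding INT by (simp add: mem_sym_ball_iff)
qed

lemma level_eventually_empty: "\<exists>T>0. \<forall>t\<ge>T. level t = {}"
proof -
  have "\<exists>k. level (real (Suc k)) = {}"
  proof (rule ccontr)
    assume "\<nexists>k. level (real (Suc k)) = {}"
    then have "(\<Inter>k. level (real (Suc k))) \<noteq> {}"
      by (intro compact_nest compact_level) auto
    then obtain x where x: "\<And>k. real (Suc k) \<le> f x" by auto
    obtain k where "f x < real k" using reals_Archimedean2 by blast
    with x[of k] show False by simp
  qed
  then obtain k where k: "level (real (Suc k)) = {}" by blast
  have "level t = {}" if "real (Suc k) \<le> t" for t using k that order_trans by blast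
  then show ?thesis by (intro exI[of _ "real (Suc k)"]) simp
qed

lemma sym_rearrangement_superlevel:
  "0 \<le> sym_rearrangement f x" "0 < t \<Longrightarrow> {x. t \<le> sym_rearrangement f x} = sym_ball (level t)"
proof -
  obtain T where T: "0 < T" "\<And>t. T \<le> t \<Longrightarrow> level t = {}" using level_eventually_empty by blast
  have "\<exists>!h::'a \<Rightarrow> real. (\<forall>x. 0 \<le> h x) \<and> (\<forall>t>0. {x. h x \<ge> t} = sym_ball (level t))"
  proof (rule ex_function_with_superlevels[where T=T])
    show "sym_ball (level t) = {}" if "T \<le> t" for t using T(2)[OF that] by (simp add: sym_ball_def)
  qed (use sym_ball_level_antimono sym_ball_level_left_closed T(1) in auto)
  from theI'[OF this] have "(\<forall>x. 0 \<le> sym_rearrangement f x) \<and> (\<forall>t>0. {x. sym_rearrangement f x \<ge> t} = sym_ball (level t))"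
    unfolding sym_rearrangement_def .
  then show "0 \<le> sym_rearrangement f x" "0 < t \<Longrightarrow> {x. t \<le> sym_rearrangement f x} = sym_ball (level t)" by auto
qed

lemma total_mass_sym_rearrangement: "total_mass (sym_rearrangement f) = total_mass f"
proof (rule total_mass_cong_superlevels)
  show "sym_rearrangement f \<in> borel_measurable borel"
    by (rule borel_measurable_of_superlevels)
       (auto simp: sym_rearrangement_superlevel compact_sym_ball compact_imp_borel)
  fix t :: real assume t: "0 < t"
  have "emeasure lborel {x. t \<le> sym_rearrangement f x} = ennreal (measure lebesgue (sym_ball (level t)))"
    unfolding sym_rearrangement_superlevel(2)[OF t] by (rule emeasure_compact[OF compact_sym_ball])
  also have "\<dots> = emeasure lborel (level t)"
    unfolding measure_sym_ball by (rule emeasure_compact[OF compact_level[OF t], symmetric])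
  finally show "emeasure lborel {x. t \<le> sym_rearrangement f x} = emeasure lborel {x. t \<le> f x}" .
qed (auto simp: nonneg sym_rearrangement_superlevel)

text \<open>The epigraph of the base function is convex and contains the generating points, so it contains
  their hull and the inner linearization stays below \<open>f\<close>. This bounds the infimum in
  \<^const>\<open>G_functional\<close> from below.\<close>

lemma total_mass_inner_lin_le:
  assumes Y: "finite Y" "Y \<noteq> {}" "Y \<subseteq> hypograph f"
  shows "total_mass (inner_lin \<alpha> Y) \<le> total_mass f"
proof -
  interpret hypo_points Y using Y by unfold_locales (auto simp: hypograph_def)
  have sub: "convex hull base_points \<alpha> Y \<subseteq> base_epi \<alpha> f"
  proof (rule hull_minimal)
    show "convex (base_epi \<alpha> f)" by (rule convex_base_epi[OF nonneg concave])
    show "base_points \<alpha> Y \<subseteq> base_epi \<alpha> f"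
    proof
      fix p assume "p \<in> base_points \<alpha> Y"
      then obtain x s where "(x, s) \<in> Y" "p = (x, base_val \<alpha> s)" by (auto simp: base_points_def)
      then show "p \<in> base_epi \<alpha> f" using Y(3) mem_epi_iff[of s x] by (auto simp: hypograph_def)
    qed
  qed
  have "inner_lin \<alpha> Y x \<le> f x" for x
  proof (cases "0 < inner_lin \<alpha> Y x")
    case True
    then obtain y where y: "y \<le> base_val \<alpha> (inner_lin \<alpha> Y x)" "(x, y) \<in> base_epi \<alpha> f"
      using le_inner_lin_iff[OF True, of \<alpha> x] sub by blast
    then have "(x, base_val \<alpha> (inner_lin \<alpha> Y x)) \<in> base_epi \<alpha> f" by (auto simp: base_epi_def)
    then show ?thesis using mem_epi_iff[OF True] by simp
  next
    case False
    then show ?thesis using nonneg[of x] by linarith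
  qed
  then show ?thesis unfolding total_mass_def by (intro integral_mono' f_integrable nonneg)
qed

lemma G_functional_le:
  assumes "finite Y" "Y \<noteq> {}" "Y \<subseteq> hypograph f" "card Y \<le> N"
  shows "G_functional N \<alpha> f \<le> total_mass f - total_mass (inner_lin \<alpha> Y)"
proof -
  interpret hypo_points Y using assms by unfold_locales (auto simp: hypograph_def)
  have "inner_lin \<alpha> Y \<in> inner_linearizations \<alpha> N f"
    unfolding inner_linearizations_def inner_lin_def
    using assms break_points_card_le[of \<alpha>] by (auto intro!: exI[of _ Y])
  moreover have "bdd_below ((\<lambda>q. total_mass f - total_mass q) ` inner_linearizations \<alpha> N f)"
    using total_mass_inner_lin_le
    by (intro bdd_belowI2[of _ 0]) (auto simp: inner_linearizations_def inner_lin_def)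
  ultimately show ?thesis unfolding G_functional_def by (intro cINF_lower) auto
qed

text \<open>The points \<open>c *\<^sub>R x\<close> at the levels \<open>c * s\<close> fit into the balls of radius \<open>c\<close> times that of the superlevel sets of \<open>f\<close> at the
  levels \<open>c * s\<close>. Hence \<open>mass_le_of_balls\<close> produces points below the graph of \<open>f\<close> at the same
  levels with at least the same mass.\<close>

lemma G_functional_le_scaled_rearranged_points:
  assumes Z: "finite Z" "Z \<noteq> {}" "Z \<subseteq> hypograph (sym_rearrangement f)" and card: "card Z \<le> N"
    and c: "0 < c" "c < 1"
  shows "G_functional N \<alpha> f \<le> total_mass f - c ^ (DIM('a) + 1) * total_mass (inner_lin \<alpha> Z)"
proof -
  interpret lev: level_family Z snd \<alpha> using Z by unfold_locales (auto simp: hypograph_def)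
  interpret scaled: level_family Z "\<lambda>z. c * snd z" \<alpha> using Z c by unfold_locales (auto simp: hypograph_def)
  have hyp: "0 < snd z" "level (snd z) \<noteq> {}" "measure lebesgue (cball (0::'a) (norm (fst z))) \<le> measure lebesgue (level (snd z))"
    if "z \<in> Z" for z
  proof -
    have "0 < snd z" "snd z \<le> sym_rearrangement f (fst z)" using Z(3) that by (auto simp: hypograph_def)
    then have "fst z \<in> sym_ball (level (snd z))" using sym_rearrangement_superlevel(2) by blast
    then show "0 < snd z" "level (snd z) \<noteq> {}" "measure lebesgue (cball (0::'a) (norm (fst z))) \<le> measure lebesgue (level (snd z))"
      using \<open>0 < snd z\<close> by (auto simp: mem_sym_ball_iff)
  qed
  have cs: "0 < c * snd z" if "z \<in> Z" for z using hyp(1)[OF that] c by simp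
  have "\<forall>z\<in>Z. \<exists>r\<ge>0. measure lebesgue (cball (0::'a) r) = measure lebesgue (level (c * snd z))"
    using ex1_ball_radius[where 'a='a] measure_nonneg by metis
  then obtain r where r: "\<And>z. z \<in> Z \<Longrightarrow> 0 \<le> r z"
      "\<And>z. z \<in> Z \<Longrightarrow> measure lebesgue (cball (0::'a) (r z)) = measure lebesgue (level (c * snd z))"
    by metis
  have rpos: "0 < r z" if "z \<in> Z" for z
  proof -
    have "0 < measure lebesgue (cball (0::'a) (r z))" using lower_level_fat[OF hyp(1,2)[OF that] c] r(2)[OF that] by simp
    then show ?thesis by simp
  qed
  have norm_le: "norm (fst z) \<le> r z" if z: "z \<in> Z" for z
  proof -
    have "level (snd z) \<subseteq> level (c * snd z)" using hyp(1)[OF z] c by (auto intro: order_trans[rotated])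
    then have "measure lebesgue (level (snd z)) \<le> measure lebesgue (level (c * snd z))"
      using compact_level[OF cs[OF z]] compact_level[OF hyp(1)[OF z]]
      by (intro measure_mono_fmeasurable) (auto intro!: lmeasurable_compact fmeasurableD)
    with hyp(3)[OF z] have "measure lebesgue (cball (0::'a) (norm (fst z))) \<le> measure lebesgue (cball (0::'a) (r z))"
      using r(2)[OF z] by simp
    then show ?thesis using content_cball_le_iff[where 'a='a, of "norm (fst z)" "r z"] r(1)[OF z] by simp
  qed
  have vol: "emeasure lborel (cball (0::'a) (r z)) \<le> emeasure lborel (level (c * snd z))" if z: "z \<in> Z" for z
    unfolding emeasure_compact[OF compact_cball] emeasure_compact[OF compact_level[OF cs[OF z]]] r(2)[OF z] ..
  obtain x where x: "\<And>z. z \<in> Z \<Longrightarrow> x z \<in> level (c * snd z)" "scaled.mass (\<lambda>z. c *\<^sub>R fst z) \<le> scaled.mass x"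
  proof (rule scaled.mass_le_of_balls[of "\<lambda>z. level (c * snd z)" r c "\<lambda>z. c *\<^sub>R fst z"])
    show "norm (c *\<^sub>R fst z) \<le> c * r z" if "z \<in> Z" for z using norm_le[OF that] c by simp
  qed (use compact_level[OF cs] convex_level[OF cs] rpos vol c in auto)
  have "lev.pts fst = Z" unfolding lev.pts_def by force
  then have "c ^ (DIM('a) + 1) * total_mass (inner_lin \<alpha> Z) = scaled.mass (\<lambda>z. c *\<^sub>R fst z)"
    using lev.mass_scale[OF c(1), of fst] by (simp add: lev.mass_def)
  also have "\<dots> \<le> total_mass (inner_lin \<alpha> (scaled.pts x))" using x(2) by (simp add: scaled.mass_def)
  finally have "total_mass f - total_mass (inner_lin \<alpha> (scaled.pts x)) \<le> total_mass f - c ^ (DIM('a) + 1) * total_mass (inner_lin \<alpha> Z)"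
    by simp
  moreover have "G_functional N \<alpha> f \<le> total_mass f - total_mass (inner_lin \<alpha> (scaled.pts x))"
  proof (rule G_functional_le)
    show "finite (scaled.pts x)" "scaled.pts x \<noteq> {}" using Z by (auto simp: scaled.pts_def)
    show "scaled.pts x \<subseteq> hypograph f" using x(1) cs by (auto simp: scaled.pts_def hypograph_def)
    show "card (scaled.pts x) \<le> N" unfolding scaled.pts_def using card card_image_le[OF Z(1)] order_trans by blast
  qed
  ultimately show ?thesis by linarith
qed

lemma G_functional_le_rearranged_points:
  assumes Z: "finite Z" "Z \<noteq> {}" "Z \<subseteq> hypograph (sym_rearrangement f)" and card: "card Z \<le> N"
  shows "G_functional N \<alpha> f \<le> total_mass f - total_mass (inner_lin \<alpha> Z)"
proof -
  have "((\<lambda>c. total_mass f - c ^ (DIM('a) + 1) * total_mass (inner_lin \<alpha> Z)) \<longlongrightarrow>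
      total_mass f - 1 ^ (DIM('a) + 1) * total_mass (inner_lin \<alpha> Z)) (at_left 1)"
    by (intro tendsto_intros)
  moreover have "eventually (\<lambda>c. G_functional N \<alpha> f \<le> total_mass f - c ^ (DIM('a) + 1) * total_mass (inner_lin \<alpha> Z)) (at_left 1)"
    using eventually_at_left_field G_functional_le_scaled_rearranged_points[OF Z card]
    by (auto simp: eventually_at_left_field intro!: exI[of _ 0])
  ultimately show ?thesis by (auto intro!: tendsto_lowerbound)
qed

end

section \<open>Rearrangement does not decrease the approximation error\<close>

theorem theorem4p2:
  fixes N :: nat and \<alpha> :: real and f :: "real ^ 'n \<Rightarrow> real"
  assumes "CARD('n) + 2 \<le> N"
    and "\<alpha> \<in> admissible_alphas"
    and "f \<in> C_class \<alpha>"
  shows "G_functional N \<alpha> f \<le> G_functional N \<alpha> (sym_rearrangement f)"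
proof -
  interpret alpha_concave_function \<alpha> f by unfold_locales (rule assms(3))
  let ?h = "sym_rearrangement f"
  show ?thesis
    unfolding G_functional_def[of N \<alpha> ?h]
  proof (rule cINF_greatest)
    have "0 \<in> sym_ball (level (f 0))" by (auto simp: mem_sym_ball_iff)
    then have le: "f 0 \<le> ?h 0" using sym_rearrangement_superlevel(2)[OF origin] by blast
    let ?Y = "{(0 :: real ^ 'n, f 0)}"
    interpret point: hypo_points ?Y using origin by unfold_locales auto
    have "card ?Y \<le> N" using assms(1) by simp
    then have "inner_lin \<alpha> ?Y \<in> inner_linearizations \<alpha> N ?h"
      unfolding inner_linearizations_def inner_lin_def
      using le origin point.break_points_card_le[of \<alpha>] by (auto simp: hypograph_def intro!: exI[of _ ?Y])
    then show "inner_linearizations \<alpha> N ?h \<noteq> {}" by blast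
  next
    fix q assume "q \<in> inner_linearizations \<alpha> N ?h"
    then obtain Y where Y: "finite Y" "Y \<noteq> {}" "Y \<subseteq> hypograph ?h" "q = inner_lin \<alpha> Y"
      "finite (break_points (inner_lin_base \<alpha> Y))" "card (break_points (inner_lin_base \<alpha> Y)) \<le> N"
      unfolding inner_linearizations_def inner_lin_def by blast
    interpret hypo_points Y using Y by unfold_locales (auto simp: hypograph_def)
    obtain Z where Z: "Z \<subseteq> Y" "Z \<noteq> {}" "inner_lin_base \<alpha> Z = inner_lin_base \<alpha> Y"
      "card Z \<le> card (break_points (inner_lin_base \<alpha> Y))"
      using break_points_reduce[of \<alpha>] Y(5) by metis
    have "finite Z" using Z Y finite_subset by blast
    then have "G_functional N \<alpha> f \<le> total_mass f - total_mass (inner_lin \<alpha> Z)"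
      using Z Y by (intro G_functional_le_rearranged_points) auto
    moreover have "inner_lin \<alpha> Z = q" by (simp add: inner_lin_def Z(3) Y(4))
    ultimately show "G_functional N \<alpha> f \<le> total_mass ?h - total_mass q"
      by (simp add: total_mass_sym_rearrangement)
  qed
qed

end
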